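(* Suppose the $\mathbb{C}P^{N-1}$ sigma model is defined on the sphere $S^2$ and its action functional is finite. Let $f$ be a holomorphic ($\bar\partial f=0$) or antiholomorphic ($\partial f=0$) solution of the model, and let $P=I_N-\frac{f\otimes f^\dagger}{f^\dagger\cdot f}$ be the associated orthogonal projector of rank $N-1$. Then the generalized Weierstrass formula for immersion $X$ of the associated surface $\mathcal{F}$ in $su(N)$ can be expressed in terms of $P$ by $$X(\xi,\bar\xi)=\epsilon\, i\left(\frac{1-N}{N}I_N+P\right),\qquad \epsilon=\pm1 .$$ The surface $\mathcal{F}$ is determined uniquely up to Euclidean motions by its first and second fundamental forms $$I=\mathrm{tr}(\partial P\,\bar\partial P)\,d\xi\,d\bar\xi$$ and $$II=\epsilon i\Big\{(\partial^2P-\Gamma_{11}^1\partial P-\Gamma_{11}^2\bar\partial P)\,d\xi^2+2\,\partial\bar\partial P\,d\xi\,d\bar\xi+(\bar\partial^2P-\Gamma_{22}^1\partial P-\Gamma_{22}^2\bar\partial P)\,d\bar\xi^2\Big\},$$ respectively, where the Christoffel symbols of the second kind are $$\Gamma_{11}^1=\frac{\mathrm{tr}(\partial^2P\,\bar\partial P)}{\mathrm{tr}(\partial P\,\bar\partial P)},\quad \Gamma_{11}^2=\frac{\mathrm{tr}(\partial^2P\,\partial P)}{\mathrm{tr}(\partial P\,\bar\partial P)},\quad \Gamma_{12}^1=\Gamma_{21}^1=0,$$ $$\Gamma_{22}^1=\frac{\mathrm{tr}(\bar\partial^2P\,\bar\partial P)}{\mathrm{tr}(\partial P\,\bar\partial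 P)},\quad \Gamma_{22}^2=\frac{\mathrm{tr}(\bar\partial^2P\,\partial P)}{\mathrm{tr}(\partial P\,\bar\partial P)},\quad \Gamma_{12}^2=\Gamma_{21}^2=0 .$$
   Context: $\xi=\xi^1+i\xi^2$, $\partial=\frac12(\partial_{\xi^1}-i\partial_{\xi^2})$, $\bar\partial=\frac12(\partial_{\xi^1}+i\partial_{\xi^2})$; $\dagger$ is Hermitian conjugation and $I_N$ the $N\times N$ identity matrix. Solutions of the model are the $\mathbb{C}^N$-valued functions $f$ whose projector $P$ satisfies the Euler-Lagrange equation $\partial[\bar\partial P,P]+\bar\partial[\partial P,P]=0$. With $z=f(f^\dagger\cdot f)^{-1/2}$ and $D_\mu z=\partial_{\xi^\mu}z-(z^\dagger\cdot\partial_{\xi^\mu}z)z$, the action is $S=\frac14\int(D_\mu z)^\dagger(D_\mu z)\,d\xi d\bar\xi$ (summed over $\mu=1,2$). The generalized Weierstrass formula for immersion is $X(\xi,\bar\xi)=i\int_\gamma\left(-[\partial P,P]\,d\xi+[\bar\partial P,P]\,d\bar\xi\right)$, where the integrand is a closed 1-form and the integral depends only on the end points of the curve $\gamma$; $X$ takes values in $su(N)\simeq\mathbb{R}^{N^2-1}$, with scalar product $\langle A,B\rangle=-\frac12\mathrm{tr}(AB)$, and its entries are regarded as coordinates of the surface $\mathcal{F}$. Indices $1,2$ of the Christoffel symbols refer to $\xi,\bar\xi$. The statement is presented as an analogue of the Bonnet theorem. *)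

theory Defs
  imports "HOL-Analysis.Analysis"
begin

text \<open>
  The coordinate \<open>\<xi> = \<xi>1 + \<i> \<xi>2\<close> ranges over \<open>complex\<close>; the unit directions of \<open>\<xi>1\<close> and
  \<open>\<xi>2\<close> are \<open>1\<close> and \<open>\<i>\<close>. The number \<open>N\<close> is \<open>CARD('n)\<close>.
\<close>

section \<open>Matrices\<close>

definition cscale :: "complex \<Rightarrow> complex^'n^'n \<Rightarrow> complex^'n^'n" (infixr "\<cdot>\<^sub>C" 75) where
  "c \<cdot>\<^sub>C A = (\<chi> a b. c * A $ a $ b)"

definition dagger :: "complex^'n^'n \<Rightarrow> complex^'n^'n" where
  "dagger A = (\<chi> a b. cnj (A $ b $ a))"

definition commutator :: "complex^'n^'n \<Rightarrow> complex^'n^'n \<Rightarrow> complex^'n^'n" where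
  "commutator A B = A ** B - B ** A"

definition su :: "(complex^'n^'n) set" where
  "su = {A. dagger A = - A \<and> trace A = 0}"

text \<open>The complex bilinear extension of the scalar product of \<open>su(N)\<close>; it is real on \<open>su\<close>.\<close>

definition su_inner :: "complex^'n^'n \<Rightarrow> complex^'n^'n \<Rightarrow> complex" where
  "su_inner A B = - (1/2) * trace (A ** B)"

definition hdot :: "complex^'n \<Rightarrow> complex^'n \<Rightarrow> complex" where
  "hdot x y = (\<Sum>a\<in>UNIV. cnj (x $ a) * y $ a)"


section \<open>Differentiation\<close>

text \<open>To be used with open \<open>U\<close> only.\<close>

definition C1_on :: "complex set \<Rightarrow> (complex \<Rightarrow> 'b::real_normed_vector) \<Rightarrow> bool" where
  "C1_on U F \<longleftrightarrow> (\<forall>\<xi>\<in>U. F differentiable (at \<xi>)) \<and>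
     (\<forall>v. continuous_on U (\<lambda>\<xi>. frechet_derivative F (at \<xi>) v))"

definition C2_on :: "complex set \<Rightarrow> (complex \<Rightarrow> 'b::real_normed_vector) \<Rightarrow> bool" where
  "C2_on U F \<longleftrightarrow> (\<forall>\<xi>\<in>U. F differentiable (at \<xi>)) \<and>
     (\<forall>v. C1_on U (\<lambda>\<xi>. frechet_derivative F (at \<xi>) v))"

text \<open>
  Index \<open>1\<close> is the derivative along \<open>\<xi>\<close>, index \<open>2\<close> the one along the conjugate coordinate.
  (In the type \<open>2\<close> one has \<open>UNIV = {1, 2}\<close> and \<open>1 \<noteq> 2\<close>.)
\<close>

definition wirtinger :: "2 \<Rightarrow> (complex \<Rightarrow> complex) \<Rightarrow> complex \<Rightarrow> complex" where
  "wirtinger k g \<xi> = (1/2) * (frechet_derivative g (at \<xi>) 1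
     + (if k = 1 then - \<i> else \<i>) * frechet_derivative g (at \<xi>) \<i>)"

definition vec_wirtinger :: "2 \<Rightarrow> (complex \<Rightarrow> complex^'n) \<Rightarrow> complex \<Rightarrow> complex^'n" where
  "vec_wirtinger k f \<xi> = (\<chi> a. wirtinger k (\<lambda>\<zeta>. f \<zeta> $ a) \<xi>)"

definition mat_wirtinger :: "2 \<Rightarrow> (complex \<Rightarrow> complex^'n^'n) \<Rightarrow> complex \<Rightarrow> complex^'n^'n" where
  "mat_wirtinger k F \<xi> = (\<chi> a b. wirtinger k (\<lambda>\<zeta>. F \<zeta> $ a $ b) \<xi>)"

abbreviation dM :: "(complex \<Rightarrow> complex^'n^'n) \<Rightarrow> complex \<Rightarrow> complex^'n^'n" where
  "dM \<equiv> mat_wirtinger 1"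

abbreviation dbarM :: "(complex \<Rightarrow> complex^'n^'n) \<Rightarrow> complex \<Rightarrow> complex^'n^'n" where
  "dbarM \<equiv> mat_wirtinger 2"

definition holomorphic_vec :: "complex set \<Rightarrow> (complex \<Rightarrow> complex^'n) \<Rightarrow> bool" where
  "holomorphic_vec U f \<longleftrightarrow> (\<forall>\<xi>\<in>U. vec_wirtinger 2 f \<xi> = 0)"

definition antiholomorphic_vec :: "complex set \<Rightarrow> (complex \<Rightarrow> complex^'n) \<Rightarrow> bool" where
  "antiholomorphic_vec U f \<longleftrightarrow> (\<forall>\<xi>\<in>U. vec_wirtinger 1 f \<xi> = 0)"


section \<open>The sigma model\<close>

definition projector :: "(complex \<Rightarrow> complex^'n) \<Rightarrow> complex \<Rightarrow> complex^'n^'n" where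
  "projector f \<xi> = mat 1 - (\<chi> a b. f \<xi> $ a * cnj (f \<xi> $ b) / hdot (f \<xi>) (f \<xi>))"

definition model_solution :: "complex set \<Rightarrow> (complex \<Rightarrow> complex^'n) \<Rightarrow> bool" where
  "model_solution U f \<longleftrightarrow>
     C2_on U f \<and> (\<forall>\<xi>\<in>U. f \<xi> \<noteq> 0) \<and>
     (\<forall>\<xi>\<in>U. dM (\<lambda>\<zeta>. commutator (dbarM (projector f) \<zeta>) (projector f \<zeta>)) \<xi>
           + dbarM (\<lambda>\<zeta>. commutator (dM (projector f) \<zeta>) (projector f \<zeta>)) \<xi> = 0)"

text \<open>
  The sphere is the plane together with the chart \<open>w = 1/\<xi>\<close> at infinity. Homogeneous coordinates
  \<open>f\<close> of a map from the sphere to the projective space cannot in general be chosen without zeros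
  and poles on the whole sphere; what is globally defined is the map itself, that is, its projector.
\<close>

definition C2_on_sphere :: "(complex \<Rightarrow> 'b::real_normed_vector) \<Rightarrow> bool" where
  "C2_on_sphere F \<longleftrightarrow> C2_on UNIV F \<and>
     (\<exists>Finf. C2_on UNIV (\<lambda>w. if w = 0 then Finf else F (inverse w)))"

definition defined_on_sphere :: "complex set \<Rightarrow> (complex \<Rightarrow> complex^'n) \<Rightarrow> bool" where
  "defined_on_sphere U f \<longleftrightarrow>
     (\<exists>Q. C2_on_sphere Q \<and> (\<forall>\<xi>\<in>U. Q \<xi> = projector f \<xi>))"

definition unit_field :: "(complex \<Rightarrow> complex^'n) \<Rightarrow> complex \<Rightarrow> complex^'n" where
  "unit_field f \<xi> = (1 / csqrt (hdot (f \<xi>) (f \<xi>))) *s f \<xi>"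

definition covariant_derivative ::
    "(complex \<Rightarrow> complex^'n) \<Rightarrow> complex \<Rightarrow> complex \<Rightarrow> complex^'n" where
  "covariant_derivative z v \<xi> =
     frechet_derivative z (at \<xi>) v - hdot (z \<xi>) (frechet_derivative z (at \<xi>) v) *s z \<xi>"

text \<open>
  The area element is normalised as Lebesgue measure; another normalisation multiplies the action
  by a positive constant.
\<close>

definition action :: "complex set \<Rightarrow> (complex \<Rightarrow> complex^'n) \<Rightarrow> ennreal" where
  "action U f = ennreal (1/4) *
     (\<integral>\<^sup>+ \<xi>\<in>U. ennreal (\<Sum>v\<in>{1, \<i>}.
        Re (hdot (covariant_derivative (unit_field f) v \<xi>)
                 (covariant_derivative (unit_field f) v \<xi>))) \<partial>lborel)"


section \<open>The generalized Weierstrass formula\<close>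

definition has_weierstrass_integral ::
    "(complex \<Rightarrow> complex^'n^'n) \<Rightarrow> (real \<Rightarrow> complex) \<Rightarrow> complex^'n^'n \<Rightarrow> bool" where
  "has_weierstrass_integral P \<gamma> A \<longleftrightarrow>
     ((\<lambda>t. \<i> \<cdot>\<^sub>C
         (vector_derivative \<gamma> (at t within {0..1}) \<cdot>\<^sub>C (- commutator (dM P (\<gamma> t)) (P (\<gamma> t)))
          + cnj (vector_derivative \<gamma> (at t within {0..1})) \<cdot>\<^sub>C
              commutator (dbarM P (\<gamma> t)) (P (\<gamma> t))))
       has_integral A) {0..1}"

text \<open>
  The formula determines \<open>X\<close> up to a constant of integration in \<open>su\<close> (the position of the initial
  point of the curves), so it is stated for the increments of \<open>X\<close>.
\<close>

definition weierstrass_immersion ::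
    "complex set \<Rightarrow> (complex \<Rightarrow> complex^'n^'n) \<Rightarrow> (complex \<Rightarrow> complex^'n^'n) \<Rightarrow> bool" where
  "weierstrass_immersion U P X \<longleftrightarrow>
     (\<forall>\<xi>\<in>U. X \<xi> \<in> su) \<and>
     (\<forall>\<gamma>. valid_path \<gamma> \<longrightarrow> path_image \<gamma> \<subseteq> U \<longrightarrow>
        has_weierstrass_integral P \<gamma> (X (pathfinish \<gamma>) - X (pathstart \<gamma>)))"


section \<open>Surfaces in \<open>su(N)\<close>\<close>

definition regular_points :: "complex set \<Rightarrow> (complex \<Rightarrow> complex^'n^'n) \<Rightarrow> complex set" where
  "regular_points U X = {\<xi>\<in>U. inj (frechet_derivative X (at \<xi>))}"

text \<open>
  The fundamental forms are quadratic forms in the tangent vector \<open>v\<close> of the parameter plane,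
  on which \<open>d\<xi>\<close> and its conjugate take the values \<open>v\<close> and \<open>cnj v\<close>. The second one takes values
  in the normal space, as the codimension of the surface is in general greater than one.
\<close>

definition first_form :: "(complex \<Rightarrow> complex^'n^'n) \<Rightarrow> complex \<Rightarrow> complex \<Rightarrow> complex" where
  "first_form X \<xi> v =
     su_inner (frechet_derivative X (at \<xi>) v) (frechet_derivative X (at \<xi>) v)"

definition normal_part ::
    "(complex \<Rightarrow> complex^'n^'n) \<Rightarrow> complex \<Rightarrow> complex^'n^'n \<Rightarrow> complex^'n^'n" where
  "normal_part X \<xi> A = (THE B. A - B \<in> range (frechet_derivative X (at \<xi>)) \<and>
     (\<forall>T\<in>range (frechet_derivative X (at \<xi>)). su_inner B T = 0))"

definition second_form :: "(complex \<Rightarrow> complex^'n^'n) \<Rightarrow> complex \<Rightarrow> complex \<Rightarrow> complex^'n^'n" where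
  "second_form X \<xi> v = normal_part X \<xi>
     (frechet_derivative (\<lambda>\<zeta>. frechet_derivative X (at \<zeta>) v) (at \<xi>) v)"

definition metric :: "(complex \<Rightarrow> complex^'n^'n) \<Rightarrow> complex \<Rightarrow> complex^2^2" where
  "metric X \<xi> = (\<chi> i j. su_inner (mat_wirtinger i X \<xi>) (mat_wirtinger j X \<xi>))"

text \<open>\<open>christoffel X \<xi> k i j\<close> has the upper index \<open>k\<close> and the lower indices \<open>i\<close>, \<open>j\<close>.\<close>

definition christoffel ::
    "(complex \<Rightarrow> complex^'n^'n) \<Rightarrow> complex \<Rightarrow> 2 \<Rightarrow> 2 \<Rightarrow> 2 \<Rightarrow> complex" where
  "christoffel X \<xi> k i j = (1/2) * (\<Sum>l\<in>UNIV. matrix_inv (metric X \<xi>) $ k $ l *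
     (wirtinger i (\<lambda>\<zeta>. metric X \<zeta> $ j $ l) \<xi>
      + wirtinger j (\<lambda>\<zeta>. metric X \<zeta> $ i $ l) \<xi>
      - wirtinger l (\<lambda>\<zeta>. metric X \<zeta> $ i $ j) \<xi>))"

definition su_isometry :: "(complex^'n^'n \<Rightarrow> complex^'n^'n) \<Rightarrow> bool" where
  "su_isometry L \<longleftrightarrow> linear L \<and> L ` su \<subseteq> su \<and>
     (\<forall>A\<in>su. \<forall>B\<in>su. su_inner (L A) (L B) = su_inner A B)"

definition euclidean_motion :: "(complex^'n^'n \<Rightarrow> complex^'n^'n) \<Rightarrow> bool" where
  "euclidean_motion T \<longleftrightarrow> (\<exists>L C. su_isometry L \<and> C \<in> su \<and> (\<forall>A\<in>su. T A = L A + C))"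

text \<open>
  A Euclidean motion with linear part \<open>L\<close> leaves the first fundamental form unchanged and applies
  \<open>L\<close> to the values of the second one; two surfaces therefore have the same second fundamental
  form if these values agree after one fixed isometry of \<open>su\<close>.
\<close>

definition same_fundamental_forms ::
    "complex set \<Rightarrow> (complex \<Rightarrow> complex^'n^'n) \<Rightarrow> (complex \<Rightarrow> complex^'n^'n) \<Rightarrow> bool" where
  "same_fundamental_forms U X Y \<longleftrightarrow>
     (\<forall>\<xi>\<in>U. \<forall>v. first_form Y \<xi> v = first_form X \<xi> v) \<and>
     (\<exists>L. su_isometry L \<and> (\<forall>\<xi>\<in>U. \<forall>v. second_form Y \<xi> v = L (second_form X \<xi> v)))"

end

theory Submission
  imports Defs "HOL-Complex_Analysis.Complex_Analysis"
begin

text \<open>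
  Differentiating \<open>P f = 0\<close> and \<open>P\<^sup>2 = P\<close> shows that the commutators of \<open>P\<close> with its two Wirtinger
  derivatives are multiples \<open>\<plusminus>1\<close> of these derivatives, so the Weierstrass form is \<open>\<epsilon> \<i> dP\<close>. It also
  makes the parametrization conformal, and the Christoffel symbols and second fundamental form follow.

  For the uniqueness, let \<open>Y\<close> have the fundamental forms of \<open>X\<close> up to the isometry \<open>L\<close>, and set
  \<open>H = Y - L X\<close>. In a conformal parametrization the Laplacian of a surface is normal, hence is
  determined by the second fundamental form; so \<open>H\<close> is harmonic and its \<open>\<xi>\<close>-derivative is holomorphic.
  The common first fundamental form bounds this derivative by the derivative of \<open>X\<close>, which is locally
  bounded and tends to \<open>0\<close> at infinity because \<open>P\<close> extends to the sphere. The points outside the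
  domain of \<open>Y\<close> are isolated in two steps (critical points of \<open>P\<close>, then \<open>S\<close>), so the singularities
  are removable and Liouville's theorem shows that \<open>H\<close> is constant.
\<close>

section \<open>Continuously differentiable maps\<close>

text \<open>In codimension greater than one, integrating the Gauss-Weingarten equations would also
  require the normal connection, which is not part of the data. The two surfaces are only tied by
  their equal metrics and by one isometry \<open>L\<close> matching the second forms;
  \<open>L\<close> is not known to send tangent vectors of \<open>X\<close> to those of
  \<open>Y\<close>. Harmonicity of \<open>Y - L X\<close> alone does not make it constant, so the
  argument is global, and the extension of \<open>P\<close> to the sphere supplies the missing
  control at infinity and at \<open>S\<close>. The sign comes from \<open>P\<close> projecting onto
  the complement of \<open>f\<close>: if \<open>f\<close> is holomorphic, \<open>P f = 0\<close>
  makes the conjugate derivative of \<open>P\<close> annihilate \<open>f\<close>, so its commutator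
  with \<open>P\<close> is itself, and the adjoint relation carries the opposite sign. This matches
  the signs of the Weierstrass form with \<epsilon> = 1; the antiholomorphic case exchanges both
  derivatives. The constant (1 - N)/N compensates the trace N - 1 of \<open>P\<close>.\<close>

lemma has_frechet:
  "F differentiable (at x) \<Longrightarrow> (F has_derivative frechet_derivative F (at x)) (at x)"
  by (simp add: frechet_derivative_works)

lemma frechet_eqI: "(F has_derivative F') (at x) \<Longrightarrow> frechet_derivative F (at x) = F'"
  by (rule frechet_derivative_at[symmetric])

text \<open>Both maps admit the same derivatives \<open>D\<close>, so the choice made by
  \<open>frechet_derivative\<close> agrees even at points where no derivative exists. This allows
  rewriting under a derivative without a differentiability proof.\<close>

lemma frechet_cong_open:
  assumes "open U" "x \<in> U" "\<And>y. y \<in> U \<Longrightarrow> F y = G y"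
  shows "frechet_derivative F (at x) = frechet_derivative G (at x)"
proof -
  have "(F has_derivative D) (at x) \<longleftrightarrow> (G has_derivative D) (at x)" for D
    using assms has_derivative_transform_within_open[of F D x UNIV U G]
      has_derivative_transform_within_open[of G D x UNIV U F] by auto
  then show ?thesis by (simp add: frechet_derivative_def)
qed

lemma differentiable_cong_open:
  assumes "open U" "x \<in> U" "\<And>y. y \<in> U \<Longrightarrow> F y = G y"
  shows "F differentiable (at x) \<longleftrightarrow> G differentiable (at x)"
proof -
  have "(F has_derivative D) (at x) \<longleftrightarrow> (G has_derivative D) (at x)" for D
    using assms has_derivative_transform_within_open[of F D x UNIV U G]
      has_derivative_transform_within_open[of G D x UNIV U F] by auto
  then show ?thesis by (simp add: differentiable_def)
qed

lemma C1_on_cong: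
  assumes "open U" "\<And>y. y \<in> U \<Longrightarrow> F y = G y"
  shows "C1_on U F \<longleftrightarrow> C1_on U G"
proof -
  have "continuous_on U (\<lambda>x. frechet_derivative F (at x) v) \<longleftrightarrow>
        continuous_on U (\<lambda>x. frechet_derivative G (at x) v)" for v
    by (rule continuous_on_cong) (auto simp: frechet_cong_open[OF assms(1) _ assms(2)])
  then show ?thesis
    unfolding C1_on_def using differentiable_cong_open[OF assms(1) _ assms(2)] by auto
qed

lemma C2_on_cong:
  assumes "open U" "\<And>y. y \<in> U \<Longrightarrow> F y = G y"
  shows "C2_on U F \<longleftrightarrow> C2_on U G"
proof -
  have "C1_on U (\<lambda>x. frechet_derivative F (at x) v) \<longleftrightarrow> C1_on U (\<lambda>x. frechet_derivative G (at x) v)" for v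
    by (rule C1_on_cong) (auto simp: frechet_cong_open[OF assms(1) _ assms(2)] assms)
  then show ?thesis
    unfolding C2_on_def using differentiable_cong_open[OF assms(1) _ assms(2)] by auto
qed

lemma C1_on_subset: "C1_on U F \<Longrightarrow> V \<subseteq> U \<Longrightarrow> C1_on V F"
  unfolding C1_on_def by (auto intro: continuous_on_subset)

lemma C2_on_subset: "C2_on U F \<Longrightarrow> V \<subseteq> U \<Longrightarrow> C2_on V F"
  unfolding C2_on_def by (auto intro: C1_on_subset)

lemma C1_on_differentiable: "C1_on U F \<Longrightarrow> x \<in> U \<Longrightarrow> F differentiable (at x)"
  by (simp add: C1_on_def)

lemma C2_on_differentiable: "C2_on U F \<Longrightarrow> x \<in> U \<Longrightarrow> F differentiable (at x)"
  by (simp add: C2_on_def)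

lemma C2_on_D: "C2_on U F \<Longrightarrow> C1_on U (\<lambda>x. frechet_derivative F (at x) v)"
  by (simp add: C2_on_def)

lemma C1_on_continuous: "C1_on U F \<Longrightarrow> continuous_on U F"
  by (auto simp: C1_on_def intro!: continuous_at_imp_continuous_on differentiable_imp_continuous_within)

lemma C2_on_imp_C1: "C2_on U F \<Longrightarrow> C1_on U F"
  by (auto simp: C1_on_def[of U F] C2_on_def intro: C1_on_continuous)

lemma frechet_bounded_linear:
  assumes "bounded_linear h" "F differentiable (at x)"
  shows "(\<lambda>x. h (F x)) differentiable (at x)"
    "frechet_derivative (\<lambda>x. h (F x)) (at x) = (\<lambda>v. h (frechet_derivative F (at x) v))"
proof -
  have *: "((\<lambda>x. h (F x)) has_derivative (\<lambda>v. h (frechet_derivative F (at x) v))) (at x)"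
    by (rule bounded_linear.has_derivative[OF assms(1) has_frechet[OF assms(2)]])
  then show "(\<lambda>x. h (F x)) differentiable (at x)" by (auto simp: differentiable_def)
  from * show "frechet_derivative (\<lambda>x. h (F x)) (at x) = (\<lambda>v. h (frechet_derivative F (at x) v))"
    by (rule frechet_eqI)
qed

lemma frechet_bounded_bilinear:
  assumes "bounded_bilinear h" "F differentiable (at x)" "G differentiable (at x)"
  shows "(\<lambda>x. h (F x) (G x)) differentiable (at x)"
    "frechet_derivative (\<lambda>x. h (F x) (G x)) (at x) =
      (\<lambda>v. h (F x) (frechet_derivative G (at x) v) + h (frechet_derivative F (at x) v) (G x))"
proof -
  have *: "((\<lambda>x. h (F x) (G x)) has_derivative
      (\<lambda>v. h (F x) (frechet_derivative G (at x) v) + h (frechet_derivative F (at x) v) (G x))) (at x)"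
    by (rule bounded_bilinear.FDERIV[OF assms(1) has_frechet[OF assms(2)] has_frechet[OF assms(3)]])
  then show "(\<lambda>x. h (F x) (G x)) differentiable (at x)" by (auto simp: differentiable_def)
  from * show "frechet_derivative (\<lambda>x. h (F x) (G x)) (at x) =
      (\<lambda>v. h (F x) (frechet_derivative G (at x) v) + h (frechet_derivative F (at x) v) (G x))"
    by (rule frechet_eqI)
qed

lemma frechet_add:
  assumes "F differentiable (at x)" "G differentiable (at x)"
  shows "frechet_derivative (\<lambda>x. F x + G x) (at x) =
      (\<lambda>v. frechet_derivative F (at x) v + frechet_derivative G (at x) v)"
  by (rule frechet_eqI, rule has_derivative_add) (rule has_frechet, fact)+

lemma frechet_diff:
  assumes "F differentiable (at x)" "G differentiable (at x)"
  shows "frechet_derivative (\<lambda>x. F x - G x) (at x) =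
      (\<lambda>v. frechet_derivative F (at x) v - frechet_derivative G (at x) v)"
  by (rule frechet_eqI, rule has_derivative_diff) (rule has_frechet, fact)+

lemma C1_on_bounded_linear:
  assumes "open U" "bounded_linear h" "C1_on U F"
  shows "C1_on U (\<lambda>x. h (F x))"
  unfolding C1_on_def
proof safe
  fix v
  have "continuous_on U (\<lambda>x. h (frechet_derivative F (at x) v))"
    using assms by (auto simp: C1_on_def intro: bounded_linear.continuous_on)
  then show "continuous_on U (\<lambda>x. frechet_derivative (\<lambda>x. h (F x)) (at x) v)"
    by (rule continuous_on_eq)
      (simp add: frechet_bounded_linear[OF assms(2) C1_on_differentiable[OF assms(3)]])
qed (rule frechet_bounded_linear[OF assms(2) C1_on_differentiable[OF assms(3)]])

text \<open>On \<open>U\<close> the directional derivative of the composite equals an explicit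
  expression that is already known to be C1, and since \<open>U\<close> is open the replacement is
  legitimate under one more derivative. The other closure lemmas for \<open>C2_on\<close> follow the
  same pattern.\<close>

lemma C2_on_bounded_linear:
  assumes "open U" "bounded_linear h" "C2_on U F"
  shows "C2_on U (\<lambda>x. h (F x))"
  unfolding C2_on_def
proof safe
  fix v
  have "C1_on U (\<lambda>x. h (frechet_derivative F (at x) v))"
    by (rule C1_on_bounded_linear[OF assms(1,2) C2_on_D[OF assms(3)]])
  then show "C1_on U (\<lambda>x. frechet_derivative (\<lambda>x. h (F x)) (at x) v)"
    by (subst C1_on_cong[OF assms(1)])
      (auto simp add: frechet_bounded_linear[OF assms(2) C2_on_differentiable[OF assms(3)]])
qed (rule frechet_bounded_linear[OF assms(2) C2_on_differentiable[OF assms(3)]])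

lemma C1_on_add:
  assumes "open U" "C1_on U F" "C1_on U G"
  shows "C1_on U (\<lambda>x. F x + G x)"
  unfolding C1_on_def
proof safe
  fix v
  have "continuous_on U (\<lambda>x. frechet_derivative F (at x) v + frechet_derivative G (at x) v)"
    using assms by (auto simp: C1_on_def intro: continuous_on_add)
  then show "continuous_on U (\<lambda>x. frechet_derivative (\<lambda>x. F x + G x) (at x) v)"
    by (rule continuous_on_eq)
      (simp add: frechet_add C1_on_differentiable[OF assms(2)] C1_on_differentiable[OF assms(3)])
qed (intro differentiable_add C1_on_differentiable[OF assms(2)] C1_on_differentiable[OF assms(3)])

lemma C2_on_add:
  assumes "open U" "C2_on U F" "C2_on U G"
  shows "C2_on U (\<lambda>x. F x + G x)"
  unfolding C2_on_def
proof safe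
  fix v
  have "C1_on U (\<lambda>x. frechet_derivative F (at x) v + frechet_derivative G (at x) v)"
    by (rule C1_on_add[OF assms(1) C2_on_D[OF assms(2)] C2_on_D[OF assms(3)]])
  then show "C1_on U (\<lambda>x. frechet_derivative (\<lambda>x. F x + G x) (at x) v)"
    by (subst C1_on_cong[OF assms(1)])
      (auto simp: frechet_add C2_on_differentiable[OF assms(2)] C2_on_differentiable[OF assms(3)])
qed (intro differentiable_add C2_on_differentiable[OF assms(2)] C2_on_differentiable[OF assms(3)])

lemma C1_on_const: "C1_on U (\<lambda>x. c)"
  by (simp add: C1_on_def)

lemma C2_on_const: "C2_on U (\<lambda>x. c)"
  by (simp add: C2_on_def C1_on_const)

lemma C2_on_diff:
  assumes "open U" "C2_on U F" "C2_on U G"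
  shows "C2_on U (\<lambda>x. F x - G x)"
proof -
  have "C2_on U (\<lambda>x. F x + - G x)"
    by (rule C2_on_add[OF assms(1,2) C2_on_bounded_linear[OF assms(1) bounded_linear_minus[OF bounded_linear_ident] assms(3)]])
  then show ?thesis by simp
qed

lemma C1_on_bounded_bilinear:
  assumes "open U" "bounded_bilinear h" "C1_on U F" "C1_on U G"
  shows "C1_on U (\<lambda>x. h (F x) (G x))"
  unfolding C1_on_def
proof safe
  fix v
  have "continuous_on U (\<lambda>x. h (F x) (frechet_derivative G (at x) v) + h (frechet_derivative F (at x) v) (G x))"
    using assms C1_on_continuous[OF assms(3)] C1_on_continuous[OF assms(4)]
    by (auto simp: C1_on_def intro!: continuous_on_add bounded_bilinear.continuous_on[OF assms(2)])
  then show "continuous_on U (\<lambda>x. frechet_derivative (\<lambda>x. h (F x) (G x)) (at x) v)"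
    by (rule continuous_on_eq)
      (simp add: frechet_bounded_bilinear[OF assms(2)] C1_on_differentiable[OF assms(3)] C1_on_differentiable[OF assms(4)])
qed (rule frechet_bounded_bilinear[OF assms(2) C1_on_differentiable[OF assms(3)] C1_on_differentiable[OF assms(4)]])

lemma C2_on_bounded_bilinear:
  assumes "open U" "bounded_bilinear h" "C2_on U F" "C2_on U G"
  shows "C2_on U (\<lambda>x. h (F x) (G x))"
  unfolding C2_on_def
proof safe
  fix v
  have "C1_on U (\<lambda>x. h (F x) (frechet_derivative G (at x) v) + h (frechet_derivative F (at x) v) (G x))"
    by (intro C1_on_add[OF assms(1)] C1_on_bounded_bilinear[OF assms(1,2)] C2_on_D C2_on_imp_C1 assms)
  then show "C1_on U (\<lambda>x. frechet_derivative (\<lambda>x. h (F x) (G x)) (at x) v)"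
    by (subst C1_on_cong[OF assms(1)])
      (auto simp: frechet_bounded_bilinear[OF assms(2)] C2_on_differentiable[OF assms(3)] C2_on_differentiable[OF assms(4)])
qed (rule frechet_bounded_bilinear[OF assms(2) C2_on_differentiable[OF assms(3)] C2_on_differentiable[OF assms(4)]])

lemma frechet_inverse:
  fixes F :: "complex \<Rightarrow> real"
  assumes "F differentiable (at x)" "F x \<noteq> 0"
  shows "(\<lambda>x. inverse (F x)) differentiable (at x)"
    "frechet_derivative (\<lambda>x. inverse (F x)) (at x) =
      (\<lambda>v. - (inverse (F x) * frechet_derivative F (at x) v * inverse (F x)))"
proof -
  have *: "((\<lambda>x. inverse (F x)) has_derivative
      (\<lambda>v. - (inverse (F x) * frechet_derivative F (at x) v * inverse (F x)))) (at x)"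
    by (rule Deriv.has_derivative_inverse[OF assms(2) has_frechet[OF assms(1)]])
  then show "(\<lambda>x. inverse (F x)) differentiable (at x)" by (auto simp: differentiable_def)
  from * show "frechet_derivative (\<lambda>x. inverse (F x)) (at x) =
      (\<lambda>v. - (inverse (F x) * frechet_derivative F (at x) v * inverse (F x)))"
    by (rule frechet_eqI)
qed

text \<open>The derivative formula contains the inverse again, so C1 regularity is settled before
  the second order. Real values suffice because the only denominator in the projector is the squared
  length of \<open>f\<close>.\<close>

lemma C2_on_inverse:
  fixes F :: "complex \<Rightarrow> real"
  assumes "open U" "C2_on U F" "\<And>x. x \<in> U \<Longrightarrow> F x \<noteq> 0"
  shows "C2_on U (\<lambda>x. inverse (F x))"
proof -
  note d = C2_on_differentiable[OF assms(2)]
  have c: "continuous_on U F" by (intro C1_on_continuous C2_on_imp_C1 assms)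
  have 1: "C1_on U (\<lambda>x. inverse (F x))"
    unfolding C1_on_def
  proof safe
    fix v
    have "continuous_on U (\<lambda>x. - (inverse (F x) * frechet_derivative F (at x) v * inverse (F x)))"
      by (intro continuous_intros c C1_on_continuous[OF C2_on_D[OF assms(2)]]) (use assms in auto)
    then show "continuous_on U (\<lambda>x. frechet_derivative (\<lambda>x. inverse (F x)) (at x) v)"
      by (rule continuous_on_eq) (simp add: frechet_inverse d assms)
  qed (simp add: frechet_inverse d assms)
  show ?thesis
    unfolding C2_on_def
  proof safe
    fix v
    have "C1_on U (\<lambda>x. - (inverse (F x) * frechet_derivative F (at x) v * inverse (F x)))"
      by (intro C1_on_bounded_linear[OF assms(1) bounded_linear_minus[OF bounded_linear_ident]]
          C1_on_bounded_bilinear[OF assms(1) bounded_bilinear_mult] 1 C2_on_D[OF assms(2)])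
    then show "C1_on U (\<lambda>x. frechet_derivative (\<lambda>x. inverse (F x)) (at x) v)"
      by (subst C1_on_cong[OF assms(1)]) (auto simp: frechet_inverse d assms)
  qed (simp add: frechet_inverse d assms)
qed

section \<open>Symmetry of second derivatives\<close>

lemma frechet_real_line:
  fixes F :: "complex \<Rightarrow> real"
  assumes "F differentiable (at (p + of_real t * v))"
  shows "((\<lambda>t. F (p + of_real t * v)) has_real_derivative
     frechet_derivative F (at (p + of_real t * v)) v) (at t)"
proof -
  have 1: "((\<lambda>t::real. p + of_real t * v) has_derivative (\<lambda>h. of_real h * v)) (at t)"
    by (auto intro!: derivative_eq_intros)
  have "((F \<circ> (\<lambda>t. p + of_real t * v)) has_derivative
     (frechet_derivative F (at (p + of_real t * v)) \<circ> (\<lambda>h. of_real h * v))) (at t)"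
    by (rule diff_chain_at[OF 1 has_frechet[OF assms]])
  moreover have "frechet_derivative F (at (p + of_real t * v)) (of_real h * v)
      = frechet_derivative F (at (p + of_real t * v)) v * h" for h
    using linear_cmul[OF linear_frechet_derivative[OF assms], of h v]
    by (simp add: scaleR_conv_of_real)
  ultimately show ?thesis
    by (simp add: has_field_derivative_def o_def)
qed

text \<open>Two applications of the mean value theorem to the second difference over the
  parallelogram spanned by \<open>s u\<close> and \<open>s v\<close>: along \<open>v\<close> for the
  increment of \<open>F\<close> under the shift \<open>s u\<close>, then along \<open>u\<close> for
  the derivative in direction \<open>v\<close>.\<close>

lemma double_difference:
  fixes F :: "complex \<Rightarrow> real"
  assumes "C2_on U F" "s > 0"
    and U: "\<And>a b. 0 \<le> a \<Longrightarrow> a \<le> s \<Longrightarrow> 0 \<le> b \<Longrightarrow> b \<le> s \<Longrightarrow> x + of_real a * u + of_real b * v \<in> U"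
  shows "\<exists>a b. 0 \<le> a \<and> a \<le> s \<and> 0 \<le> b \<and> b \<le> s \<and>
    F (x + of_real s * u + of_real s * v) - F (x + of_real s * u) - F (x + of_real s * v) + F x
      = s\<^sup>2 * frechet_derivative (\<lambda>\<zeta>. frechet_derivative F (at \<zeta>) v) (at (x + of_real a * u + of_real b * v)) u"
proof -
  let ?D = "\<lambda>z. frechet_derivative F (at z) v"
  have "\<exists>b>0. b < s \<and> (\<lambda>t. F (x + of_real s * u + of_real t * v) - F (x + of_real t * v)) s
      - (\<lambda>t. F (x + of_real s * u + of_real t * v) - F (x + of_real t * v)) 0
     = (s - 0) * (?D (x + of_real s * u + of_real b * v) - ?D (x + of_real b * v))"
  proof (rule MVT2[OF assms(2)])
    fix t assume t: "0 \<le> t" "t \<le> s"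
    show "((\<lambda>t. F (x + of_real s * u + of_real t * v) - F (x + of_real t * v)) has_real_derivative
         ?D (x + of_real s * u + of_real t * v) - ?D (x + of_real t * v)) (at t)"
      using U[of s t] U[of 0 t] t assms(2)
      by (intro derivative_intros frechet_real_line C2_on_differentiable[OF assms(1)]) auto
  qed
  then obtain b where b: "0 < b" "b < s" and eq1:
    "F (x + of_real s * u + of_real s * v) - F (x + of_real s * u) - F (x + of_real s * v) + F x
      = s * (?D (x + of_real s * u + of_real b * v) - ?D (x + of_real b * v))"
    by auto
  have "\<exists>a>0. a < s \<and> (\<lambda>t. ?D (x + of_real b * v + of_real t * u)) s - (\<lambda>t. ?D (x + of_real b * v + of_real t * u)) 0
     = (s - 0) * frechet_derivative ?D (at (x + of_real b * v + of_real a * u)) u"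
  proof (rule MVT2[OF assms(2)])
    fix t assume t: "0 \<le> t" "t \<le> s"
    show "((\<lambda>t. ?D (x + of_real b * v + of_real t * u)) has_real_derivative
         frechet_derivative ?D (at (x + of_real b * v + of_real t * u)) u) (at t)"
      using U[of t b] t b
      by (intro frechet_real_line C1_on_differentiable[OF C2_on_D[OF assms(1)]]) (auto simp: algebra_simps)
  qed
  then obtain a where a: "0 < a" "a < s" and eq2:
    "?D (x + of_real s * u + of_real b * v) - ?D (x + of_real b * v)
      = s * frechet_derivative ?D (at (x + of_real a * u + of_real b * v)) u"
    by (auto simp: algebra_simps)
  show ?thesis
    using a b by (intro exI[of _ a] exI[of _ b]) (simp add: eq1 eq2 power2_eq_square)
qed

text \<open>The second difference does not change when \<open>u\<close> and \<open>v\<close> are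
  exchanged, so on every small parallelogram the two mixed derivatives share a value, taken at
  possibly different points. Continuity at \<open>x\<close> then forces them to agree there.\<close>

lemma second_derivative_symmetric_real:
  fixes F :: "complex \<Rightarrow> real"
  assumes "open U" "C2_on U F" "x \<in> U"
  shows "frechet_derivative (\<lambda>\<zeta>. frechet_derivative F (at \<zeta>) v) (at x) u
       = frechet_derivative (\<lambda>\<zeta>. frechet_derivative F (at \<zeta>) u) (at x) v" (is "?A x = ?B x")
proof (rule ccontr)
  assume ne: "?A x \<noteq> ?B x"
  \<comment> \<open>Half the supposed gap: values closer than \<open>e\<close> to the two sides
    cannot coincide.\<close>
  define e where "e = \<bar>?A x - ?B x\<bar> / 2"
  have e: "e > 0" using ne by (simp add: e_def)
  have "continuous_on U ?A" "continuous_on U ?B"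
    using assms(2) by (auto simp: C2_on_def C1_on_def)
  then have "isCont ?A x" "isCont ?B x"
    using assms continuous_on_eq_continuous_at by blast+
  then have cont: "\<exists>d>0. \<forall>y. dist y x < d \<longrightarrow> dist (?A y) (?A x) < e"
      "\<exists>d>0. \<forall>y. dist y x < d \<longrightarrow> dist (?B y) (?B x) < e"
    using e unfolding continuous_at_eps_delta by blast+
  then obtain d1 d2 where d: "d1 > 0" "d2 > 0" "\<And>y. dist y x < d1 \<Longrightarrow> dist (?A y) (?A x) < e"
      "\<And>y. dist y x < d2 \<Longrightarrow> dist (?B y) (?B x) < e"
    by meson
  obtain d3 where d3: "d3 > 0" "ball x d3 \<subseteq> U"
    using assms by (meson open_contains_ball)
  define r where "r = min d1 (min d2 d3)"
  have r: "r > 0" using d d3 by (simp add: r_def)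
  \<comment> \<open>This scale keeps the whole parallelogram within distance \<open>r\<close> of
    \<open>x\<close>; the summand 1 avoids division by zero when both directions vanish.\<close>
  define s where "s = r / (2 * (norm u + norm v + 1))"
  have n: "norm u + norm v + 1 > 0" by (smt (verit) norm_ge_zero)
  have s: "s > 0" using r n by (simp add: s_def)
  have near: "dist (x + of_real a * u + of_real b * v) x < r"
    if "0 \<le> a" "a \<le> s" "0 \<le> b" "b \<le> s" for a b
  proof -
    have "norm (of_real a * u + of_real b * v) \<le> a * norm u + b * norm v"
      using that by (intro order.trans[OF norm_triangle_ineq]) (simp add: norm_mult)
    also have "\<dots> \<le> s * norm u + s * norm v"
      using that by (intro add_mono mult_right_mono) auto
    also have "\<dots> < s * (2 * (norm u + norm v + 1))"
    proof -
      have "0 \<le> s * norm u" "0 \<le> s * norm v" using s by auto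
      moreover have "s * (2 * (norm u + norm v + 1)) = 2 * (s * norm u) + 2 * (s * norm v) + 2 * s"
        by (simp add: algebra_simps)
      ultimately show ?thesis using s by linarith
    qed
    also have "\<dots> = r" using n by (simp add: s_def)
    finally show ?thesis by (simp add: dist_norm algebra_simps)
  qed
  have inU: "x + of_real a * u + of_real b * v \<in> U"
    if "0 \<le> a" "a \<le> s" "0 \<le> b" "b \<le> s" for a b
    proof -
    have "x + of_real a * u + of_real b * v \<in> ball x d3"
      using near[OF that] unfolding mem_ball r_def by (subst dist_commute) linarith
    then show ?thesis using d3 by blast
  qed
  obtain a b where ab: "0 \<le> a" "a \<le> s" "0 \<le> b" "b \<le> s" and e1:
    "F (x + of_real s * u + of_real s * v) - F (x + of_real s * u) - F (x + of_real s * v) + F x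
      = s\<^sup>2 * ?A (x + of_real a * u + of_real b * v)"
    using double_difference[OF assms(2) s, of x u v] inU by blast
  have inU': "x + of_real b * v + of_real a * u \<in> U"
    if "0 \<le> b" "b \<le> s" "0 \<le> a" "a \<le> s" for a b
    using inU[of a b] that by (simp add: algebra_simps)
  obtain a' b' where ab': "0 \<le> a'" "a' \<le> s" "0 \<le> b'" "b' \<le> s" and e2:
    "F (x + of_real s * v + of_real s * u) - F (x + of_real s * v) - F (x + of_real s * u) + F x
      = s\<^sup>2 * ?B (x + of_real b' * v + of_real a' * u)"
    using double_difference[OF assms(2) s, of x v u] inU' by blast
  have "s\<^sup>2 * ?A (x + of_real a * u + of_real b * v) = s\<^sup>2 * ?B (x + of_real b' * v + of_real a' * u)"
    using e1 e2 by (simp add: algebra_simps)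
  then have "?A (x + of_real a * u + of_real b * v) = ?B (x + of_real a' * u + of_real b' * v)"
    using s by (simp add: algebra_simps)
  moreover have "dist (?A (x + of_real a * u + of_real b * v)) (?A x) < e"
    using near[OF ab] by (intro d) (simp add: r_def)
  moreover have "dist (?B (x + of_real a' * u + of_real b' * v)) (?B x) < e"
    using near[OF ab'] by (intro d) (simp add: r_def)
  moreover have "c = d \<Longrightarrow> dist c a < \<bar>a - b\<bar> / 2 \<Longrightarrow> dist d b < \<bar>a - b\<bar> / 2 \<Longrightarrow> False" for a b c d :: real
    using dist_triangle_half_l[of a d "\<bar>a - b\<bar>" b] by (simp add: dist_commute) (simp add: dist_real_def)
  ultimately show False
    unfolding e_def by blast
qed

text \<open>The mean value theorem is available for real values only, so the symmetry is obtained
  coordinate by coordinate.\<close>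

lemma second_derivative_symmetric:
  fixes F :: "complex \<Rightarrow> 'b::euclidean_space"
  assumes "open U" "C2_on U F" "x \<in> U"
  shows "frechet_derivative (\<lambda>\<zeta>. frechet_derivative F (at \<zeta>) v) (at x) u
       = frechet_derivative (\<lambda>\<zeta>. frechet_derivative F (at \<zeta>) u) (at x) v"
proof (rule euclidean_eqI)
  fix b :: 'b assume "b \<in> Basis"
  have C: "C2_on U (\<lambda>x. F x \<bullet> b)"
    by (rule C2_on_bounded_linear[OF assms(1) bounded_linear_inner_left assms(2)])
  have 1: "frechet_derivative (\<lambda>\<zeta>. frechet_derivative (\<lambda>x. F x \<bullet> b) (at \<zeta>) v) (at x) u
       = frechet_derivative (\<lambda>\<zeta>. frechet_derivative F (at \<zeta>) v) (at x) u \<bullet> b" for u v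
  proof -
    have "frechet_derivative (\<lambda>\<zeta>. frechet_derivative (\<lambda>x. F x \<bullet> b) (at \<zeta>) v) (at x)
        = frechet_derivative (\<lambda>\<zeta>. frechet_derivative F (at \<zeta>) v \<bullet> b) (at x)"
      by (rule frechet_cong_open[OF assms(1,3)])
         (simp add: frechet_bounded_linear[OF bounded_linear_inner_left C2_on_differentiable[OF assms(2)]])
    then show ?thesis
      by (simp add: frechet_bounded_linear[OF bounded_linear_inner_left
            C1_on_differentiable[OF C2_on_D[OF assms(2)] assms(3)]])
  qed
  show "frechet_derivative (\<lambda>\<zeta>. frechet_derivative F (at \<zeta>) v) (at x) u \<bullet> b
       = frechet_derivative (\<lambda>\<zeta>. frechet_derivative F (at \<zeta>) u) (at x) v \<bullet> b"
    using second_derivative_symmetric_real[OF assms(1) C assms(3)] by (simp add: 1)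
qed

text \<open>Meant for values constrained to a linear subspace given as a kernel, in particular
  \<open>su\<close>.\<close>

lemma frechet_linear_kernel:
  assumes "open U" "bounded_linear h" "F differentiable (at x)" "x \<in> U" "\<And>y. y \<in> U \<Longrightarrow> h (F y) = 0"
  shows "h (frechet_derivative F (at x) v) = 0"
proof -
  have "frechet_derivative (\<lambda>x. h (F x)) (at x) = frechet_derivative (\<lambda>x. 0) (at x)"
    by (rule frechet_cong_open[OF assms(1,4)]) (simp add: assms)
  then show ?thesis
    using frechet_bounded_linear(2)[OF assms(2,3)] by (metis frechet_derivative_const)
qed

section \<open>Matrix algebra\<close>

lemma cscale_nth: "(c \<cdot>\<^sub>C A) $ a $ b = c * A $ a $ b"
  by (simp add: cscale_def)

lemma dagger_nth: "dagger A $ a $ b = cnj (A $ b $ a)"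
  by (simp add: dagger_def)

lemma matmul_nth: "((A::complex^'n^'n) ** B) $ a $ b = (\<Sum>k\<in>UNIV. A $ a $ k * B $ k $ b)"
  by (simp add: matrix_matrix_mult_def)

lemma mat_eqI: "(\<And>a b. A $ a $ b = B $ a $ b) \<Longrightarrow> (A :: complex^'n^'n) = B"
  by (simp add: vec_eq_iff)

lemma cscale_simps:
  "c \<cdot>\<^sub>C (A + B) = c \<cdot>\<^sub>C A + c \<cdot>\<^sub>C B"
  "c \<cdot>\<^sub>C (A - B) = c \<cdot>\<^sub>C A - c \<cdot>\<^sub>C B"
  "c \<cdot>\<^sub>C (- A) = - (c \<cdot>\<^sub>C A)"
  "(- c) \<cdot>\<^sub>C A = - (c \<cdot>\<^sub>C A)"
  "c \<cdot>\<^sub>C (d \<cdot>\<^sub>C A) = (c * d) \<cdot>\<^sub>C A"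
  "c \<cdot>\<^sub>C 0 = 0" "0 \<cdot>\<^sub>C A = 0" "1 \<cdot>\<^sub>C A = A"
  by (auto intro!: mat_eqI simp: cscale_nth algebra_simps)

lemma scaleR_eq_cscale: "r *\<^sub>R A = complex_of_real r \<cdot>\<^sub>C A"
  by (rule mat_eqI) (simp add: cscale_nth, simp add: scaleR_conv_of_real)

lemma matmul_cscale:
  "(c \<cdot>\<^sub>C A) ** B = c \<cdot>\<^sub>C (A ** B)" "A ** (c \<cdot>\<^sub>C B) = c \<cdot>\<^sub>C (A ** B)"
  by (auto intro!: mat_eqI simp: cscale_nth matmul_nth sum_distrib_left algebra_simps)

lemma matmul_uminus:
  fixes A B :: "complex^'n^'n"
  shows "(- A) ** B = - (A ** B)" "A ** (- B) = - (A ** B)"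
  by (auto intro!: mat_eqI simp: matmul_nth sum_negf)

lemma matmul_add:
  fixes A B C :: "complex^'n^'n"
  shows "(A + B) ** C = A ** C + B ** C" "C ** (A + B) = C ** A + C ** B"
  by (auto intro!: mat_eqI simp: matmul_nth sum.distrib algebra_simps)

lemma matmul_minus:
  fixes A B C :: "complex^'n^'n"
  shows "(A - B) ** C = A ** C - B ** C" "C ** (A - B) = C ** A - C ** B"
  by (auto intro!: mat_eqI simp: matmul_nth sum_subtractf algebra_simps)

lemma trace_cscale: "trace (c \<cdot>\<^sub>C A) = c * trace A"
  by (simp add: trace_def cscale_nth sum_distrib_left)

lemma dagger_simps:
  "dagger (A + B) = dagger A + dagger B"
  "dagger (A - B) = dagger A - dagger B"
  "dagger (- A) = - dagger A"
  "dagger (c \<cdot>\<^sub>C A) = cnj c \<cdot>\<^sub>C dagger A"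
  "dagger (A ** B) = dagger B ** dagger A"
  "dagger (dagger A) = A"
  "dagger 0 = 0"
  by (auto intro!: mat_eqI simp: dagger_nth cscale_nth matmul_nth mult.commute)

lemma trace_dagger: "trace (dagger A) = cnj (trace A)"
  by (simp add: trace_def dagger_nth)

lemma bounded_linear_entry: "bounded_linear (\<lambda>A :: complex^'n^'n. A $ a $ b)"
  using bounded_linear_compose[OF bounded_linear_vec_nth[of b] bounded_linear_vec_nth[of a]] .

lemma bounded_linear_cscale: "bounded_linear (\<lambda>A. c \<cdot>\<^sub>C A)"
  unfolding linear_conv_bounded_linear[symmetric]
  by (rule linearI) (auto simp: cscale_simps scaleR_eq_cscale mult.commute)

lemma bounded_linear_dagger: "bounded_linear dagger"
  unfolding linear_conv_bounded_linear[symmetric]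
  by (rule linearI) (auto simp: dagger_simps scaleR_eq_cscale)

lemma bounded_linear_trace: "bounded_linear (trace :: complex^'n^'n \<Rightarrow> complex)"
  unfolding linear_conv_bounded_linear[symmetric]
  by (rule linearI) (auto simp: trace_add trace_cscale scaleR_eq_cscale scaleR_conv_of_real)

lemma bounded_bilinear_matmul: "bounded_bilinear ((**) :: complex^'n^'n \<Rightarrow> complex^'n^'n \<Rightarrow> complex^'n^'n)"
  unfolding bilinear_conv_bounded_bilinear[symmetric] bilinear_def
  by (auto intro!: linearI simp: matmul_cscale scaleR_eq_cscale matmul_add)

lemma bounded_bilinear_trace_mult: "bounded_bilinear (\<lambda>A (B::complex^'n^'n). trace (A ** B))"
  unfolding bilinear_conv_bounded_bilinear[symmetric] bilinear_def
  by (auto intro!: linearI simp: matmul_cscale scaleR_eq_cscale matmul_add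
      trace_add trace_cscale scaleR_conv_of_real)

section \<open>The Lie algebra su(N)\<close>

text \<open>Anti-Hermitian entries satisfy \<open>B $ b $ a = - cnj (B $ a $ b)\<close>, which turns
  minus the trace into the Hermitian sum of entries; its imaginary part vanishes by cyclicity of the
  trace. On \<open>su\<close> the Euclidean inner product of the matrix type can thus replace
  \<open>su_inner\<close>, up to the factor 2 seen in later conformal factors.\<close>

lemma su_inner_real:
  assumes "A \<in> su" "B \<in> su"
  shows "su_inner A B = of_real (A \<bullet> B / 2)"
proof -
  have e: "M $ b $ a = - cnj (M $ a $ b)" if "M \<in> su" for M :: "complex^'n^'n" and a b
  proof -
    have "cnj (M $ a $ b) = - M $ b $ a" using that
      by (simp add: su_def flip: dagger_nth)
    then show ?thesis by simp
  qed
  have "A \<bullet> B = (\<Sum>a\<in>UNIV. \<Sum>b\<in>UNIV. Re (A $ a $ b * cnj (B $ a $ b)))"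
    by (simp add: inner_vec_def inner_complex_def)
  also have "\<dots> = Re (\<Sum>a\<in>UNIV. \<Sum>b\<in>UNIV. A $ a $ b * cnj (B $ a $ b))" by simp
  also have "(\<Sum>a\<in>UNIV. \<Sum>b\<in>UNIV. A $ a $ b * cnj (B $ a $ b)) = - trace (A ** B)"
  proof -
    have "trace (A ** B) = (\<Sum>a\<in>UNIV. \<Sum>b\<in>UNIV. A $ a $ b * B $ b $ a)"
      by (simp add: trace_def matmul_nth)
    also have "\<dots> = (\<Sum>a\<in>UNIV. \<Sum>b\<in>UNIV. - (A $ a $ b * cnj (B $ a $ b)))"
      by (intro sum.cong refl) (subst e[OF assms(2)], simp)
    finally show ?thesis by (simp add: sum_negf)
  qed
  finally have 1: "A \<bullet> B = - Re (trace (A ** B))" by simp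
  have "cnj (trace (A ** B)) = trace (dagger (A ** B))" by (simp add: trace_dagger)
  also have "\<dots> = trace (A ** B)"
  proof -
    have "dagger A = - A" "dagger B = - B" using assms by (auto simp: su_def)
    then have "trace (dagger (A ** B)) = trace (B ** A)" by (simp add: dagger_simps matmul_uminus)
    then show ?thesis using trace_mul_sym[of A B] by simp
  qed
  finally have "Im (trace (A ** B)) = 0" by (simp add: complex_eq_iff)
  then show ?thesis using 1 by (simp add: su_inner_def complex_eq_iff)
qed

lemma su_diff: "A \<in> su \<Longrightarrow> B \<in> su \<Longrightarrow> A - B \<in> su"
  by (simp add: su_def dagger_simps trace_sub)

lemma su_zero: "0 \<in> su"
  by (simp add: su_def dagger_simps trace_def)

text \<open>\<open>su\<close> is the common kernel of the real linear maps
  \<open>A \<mapsto> dagger A + A\<close> and \<open>trace\<close>.\<close>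

lemma frechet_in_su:
  assumes "open U" "F differentiable (at x)" "x \<in> U" "\<And>y. y \<in> U \<Longrightarrow> F y \<in> su"
  shows "frechet_derivative F (at x) v \<in> su"
proof -
  have "bounded_linear (\<lambda>A. dagger A + A)"
    by (intro bounded_linear_add bounded_linear_dagger bounded_linear_ident)
  from frechet_linear_kernel[OF assms(1) this assms(2,3), of v]
    frechet_linear_kernel[OF assms(1) bounded_linear_trace assms(2,3), of v]
  have "dagger (frechet_derivative F (at x) v) + frechet_derivative F (at x) v = 0"
    "trace (frechet_derivative F (at x) v) = 0"
    using assms(4) by (auto simp: su_def)
  then show ?thesis by (simp add: su_def eq_neg_iff_add_eq_0)
qed

section \<open>Wirtinger derivatives\<close>

text \<open>The coefficient of the derivative along \<open>\<i>\<close> as a function of the index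
  lets one formula serve both Wirtinger operators.\<close>

definition wsign :: "2 \<Rightarrow> complex" where "wsign k = (if k = 1 then - \<i> else \<i>)"

lemma one_neq_two: "(1::2) \<noteq> 2" by simp

lemma wsign_simps: "wsign 1 = - \<i>" "wsign 2 = \<i>" "wsign k * wsign k = - 1"
  using one_neq_two by (auto simp: wsign_def)

lemma wirtinger_eq: "wirtinger k g x = (1/2) * (frechet_derivative g (at x) 1 + wsign k * frechet_derivative g (at x) \<i>)"
  by (simp add: wirtinger_def wsign_def)

lemma mat_wirtinger_eq:
  assumes "F differentiable (at x)"
  shows "mat_wirtinger k F x =
    (1/2) \<cdot>\<^sub>C (frechet_derivative F (at x) 1 + wsign k \<cdot>\<^sub>C frechet_derivative F (at x) \<i>)"
  by (rule mat_eqI)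
    (simp add: mat_wirtinger_def wirtinger_eq cscale_nth frechet_bounded_linear(2)[OF bounded_linear_entry assms])

lemma wirtinger_cong_open:
  assumes "open U" "x \<in> U" "\<And>y. y \<in> U \<Longrightarrow> F y = G y"
  shows "wirtinger k F x = wirtinger k G x"
  by (simp add: wirtinger_eq frechet_cong_open[OF assms])

lemma mat_wirtinger_cong_open:
  assumes "open U" "x \<in> U" "\<And>y. y \<in> U \<Longrightarrow> F y = G y"
  shows "mat_wirtinger k F x = mat_wirtinger k G x"
  unfolding mat_wirtinger_def using assms by (auto simp: vec_eq_iff intro!: wirtinger_cong_open[of U])

lemma wirtinger_const: "wirtinger k (\<lambda>x. c) x = 0"
  by (simp add: wirtinger_eq)

lemma complex_real_combination: "v = Re v *\<^sub>R 1 + Im v *\<^sub>R \<i>"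
  by (simp add: complex_eq_iff)

lemma frechet_split:
  assumes "F differentiable (at x)"
  shows "frechet_derivative F (at x) v =
    Re v *\<^sub>R frechet_derivative F (at x) 1 + Im v *\<^sub>R frechet_derivative F (at x) \<i>"
proof -
  interpret linear "frechet_derivative F (at x)" by (rule linear_frechet_derivative[OF assms])
  show ?thesis
    by (rule trans[OF arg_cong[OF complex_real_combination]]) (simp only: add scaleR)
qed

lemma frechet_eq_wirtinger:
  assumes "F differentiable (at x)"
  shows "frechet_derivative F (at x) v = v \<cdot>\<^sub>C dM F x + cnj v \<cdot>\<^sub>C dbarM F x"
  unfolding frechet_split[OF assms, of v] mat_wirtinger_eq[OF assms]
  by (rule mat_eqI) (simp add: cscale_nth wsign_simps, simp add: complex_eq_iff field_simps)

lemma mat_wirtinger_mult: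
  assumes "F differentiable (at x)" "G differentiable (at x)"
  shows "mat_wirtinger k (\<lambda>x. F x ** G x) x = mat_wirtinger k F x ** G x + F x ** mat_wirtinger k G x"
  using assms
  by (simp add: mat_wirtinger_eq frechet_bounded_bilinear[OF bounded_bilinear_matmul]
     matmul_cscale cscale_simps matmul_add)

lemma wirtinger_trace_mult:
  assumes "F differentiable (at x)" "G differentiable (at x)"
  shows "wirtinger k (\<lambda>x. trace (F x ** G x)) x
    = trace (mat_wirtinger k F x ** G x) + trace (F x ** mat_wirtinger k G x)"
  using assms
  by (simp add: mat_wirtinger_eq wirtinger_eq frechet_bounded_bilinear[OF bounded_bilinear_trace_mult]
     matmul_cscale cscale_simps matmul_add trace_add trace_cscale algebra_simps)

lemma dagger_mat_wirtinger:
  assumes "F differentiable (at x)"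
  shows "dagger (dM F x) = dbarM (\<lambda>x. dagger (F x)) x" "dagger (dbarM F x) = dM (\<lambda>x. dagger (F x)) x"
  using assms
  by (simp_all add: mat_wirtinger_eq frechet_bounded_linear[OF bounded_linear_dagger] dagger_simps wsign_simps)

lemma C1_on_mat_wirtinger:
  assumes "open U" "C2_on U F"
  shows "C1_on U (mat_wirtinger k F)"
proof -
  have "C1_on U (\<lambda>x. (1/2) \<cdot>\<^sub>C (frechet_derivative F (at x) 1 + wsign k \<cdot>\<^sub>C frechet_derivative F (at x) \<i>))"
    by (intro C1_on_bounded_linear[OF assms(1) bounded_linear_cscale] C1_on_add C2_on_D assms)
  then show ?thesis
    by (subst C1_on_cong[OF assms(1)]) (auto simp: mat_wirtinger_eq C2_on_differentiable[OF assms(2)])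
qed

text \<open>In \<open>H u v\<close> the derivative along \<open>v\<close> is taken first. The
  expansion keeps the order of the mixed terms; their symmetry enters only when the Wirtinger
  operators are shown to commute.\<close>

lemma mat_wirtinger_mat_wirtinger:
  assumes "open U" "C2_on U F" "x \<in> U"
  defines "H \<equiv> \<lambda>u v. frechet_derivative (\<lambda>\<zeta>. frechet_derivative F (at \<zeta>) v) (at x) u"
  shows "mat_wirtinger k (mat_wirtinger l F) x =
    (1/4) \<cdot>\<^sub>C (H 1 1 + wsign l \<cdot>\<^sub>C H 1 \<i> + wsign k \<cdot>\<^sub>C H \<i> 1 + (wsign k * wsign l) \<cdot>\<^sub>C H \<i> \<i>)"
proof -
  let ?G = "\<lambda>x. (1/2) \<cdot>\<^sub>C (frechet_derivative F (at x) 1 + wsign l \<cdot>\<^sub>C frechet_derivative F (at x) \<i>)"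
  note d = C1_on_differentiable[OF C2_on_D[OF assms(2)] assms(3)]
  have "frechet_derivative (mat_wirtinger l F) (at x) = frechet_derivative ?G (at x)"
    by (rule frechet_cong_open[OF assms(1,3)]) (simp add: mat_wirtinger_eq C2_on_differentiable[OF assms(2)])
  also have "\<dots> = (\<lambda>u. (1/2) \<cdot>\<^sub>C (H u 1 + wsign l \<cdot>\<^sub>C H u \<i>))"
    unfolding H_def
    by (simp add: frechet_bounded_linear[OF bounded_linear_cscale] frechet_add d)
  finally have *: "frechet_derivative (mat_wirtinger l F) (at x) = (\<lambda>u. (1/2) \<cdot>\<^sub>C (H u 1 + wsign l \<cdot>\<^sub>C H u \<i>))" .
  show ?thesis
    unfolding mat_wirtinger_eq[OF C1_on_differentiable[OF C1_on_mat_wirtinger[OF assms(1,2)] assms(3)]] *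
    by (rule mat_eqI) (simp add: cscale_nth algebra_simps)
qed

lemma mat_wirtinger_commute:
  assumes "open U" "C2_on U F" "x \<in> U"
  shows "dbarM (dM F) x = dM (dbarM F) x"
  unfolding mat_wirtinger_mat_wirtinger[OF assms]
  using second_derivative_symmetric[OF assms, of 1 \<i>]
  by (intro mat_eqI) (simp add: cscale_nth wsign_simps algebra_simps)

lemma second_derivative_eq_wirtinger:
  assumes "open U" "C2_on U F" "x \<in> U"
  shows "frechet_derivative (\<lambda>\<zeta>. frechet_derivative F (at \<zeta>) v) (at x) v =
    v\<^sup>2 \<cdot>\<^sub>C dM (dM F) x + (2 * v * cnj v) \<cdot>\<^sub>C dM (dbarM F) x + (cnj v)\<^sup>2 \<cdot>\<^sub>C dbarM (dbarM F) x"
proof -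
  note d = C1_on_differentiable[OF C1_on_mat_wirtinger[OF assms(1,2)] assms(3)]
  have "frechet_derivative (\<lambda>\<zeta>. frechet_derivative F (at \<zeta>) v) (at x)
      = frechet_derivative (\<lambda>\<zeta>. v \<cdot>\<^sub>C dM F \<zeta> + cnj v \<cdot>\<^sub>C dbarM F \<zeta>) (at x)"
    by (rule frechet_cong_open[OF assms(1,3)]) (simp add: frechet_eq_wirtinger C2_on_differentiable[OF assms(2)])
  also have "\<dots> = (\<lambda>u. v \<cdot>\<^sub>C frechet_derivative (dM F) (at x) u + cnj v \<cdot>\<^sub>C frechet_derivative (dbarM F) (at x) u)"
    by (simp add: frechet_bounded_linear[OF bounded_linear_cscale] frechet_add d)
  finally show ?thesis
    by (simp add: frechet_eq_wirtinger[OF d] mat_wirtinger_commute[OF assms])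
      (rule mat_eqI, simp add: cscale_nth power2_eq_square algebra_simps)
qed

lemma su_inner_diff_left: "su_inner (A - B) T = su_inner A T - su_inner B T"
  by (simp add: su_inner_def matmul_minus trace_sub diff_divide_distrib)

section \<open>Conformal parametrizations\<close>

lemma conformal_polarization:
  fixes D :: "complex \<Rightarrow> 'b::real_inner"
  assumes "linear D" "\<And>v. D v \<bullet> D v = c * (norm v)\<^sup>2"
  shows "D v \<bullet> D w = c * (v \<bullet> w)"
proof -
  have "D (v + w) \<bullet> D (v + w) = D v \<bullet> D v + 2 * (D v \<bullet> D w) + D w \<bullet> D w"
    by (simp add: linear_add[OF assms(1)] inner_add_left inner_add_right inner_commute)
  moreover have "(norm (v + w))\<^sup>2 = (norm v)\<^sup>2 + 2 * (v \<bullet> w) + (norm w)\<^sup>2"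
    by (simp add: power2_norm_eq_inner inner_add_left inner_add_right inner_commute)
  ultimately show ?thesis
    unfolding assms(2) by (simp add: algebra_simps)
qed

text \<open>The difference of two candidates is tangent and normal at once. As
  \<open>su_inner\<close> is only a complex bilinear form, its definiteness on the tangent plane is
  a hypothesis here.\<close>

lemma normal_part_eqI:
  assumes "linear (frechet_derivative X (at x))"
    and "\<And>w. su_inner (frechet_derivative X (at x) w) (frechet_derivative X (at x) w) = 0 \<Longrightarrow> w = 0"
    and "A - B \<in> range (frechet_derivative X (at x))"
    and "\<And>u. su_inner B (frechet_derivative X (at x) u) = 0"
  shows "normal_part X x A = B"
  unfolding normal_part_def
proof (rule the_equality)
  let ?D = "frechet_derivative X (at x)"
  show "A - B \<in> range ?D \<and> (\<forall>T\<in>range ?D. su_inner B T = 0)"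
    using assms(3,4) by blast
  fix B' assume B': "A - B' \<in> range ?D \<and> (\<forall>T\<in>range ?D. su_inner B' T = 0)"
  then obtain w w' where w: "A - B = ?D w" "A - B' = ?D w'" using assms(3) by auto
  have eq: "B' - B = ?D (w - w')" using w by (simp add: linear_diff[OF assms(1)] flip: w)
  have "su_inner (B' - B) (?D (w - w')) = 0"
    using B' assms(4) by (simp add: su_inner_diff_left)
  then have "w - w' = 0" unfolding eq by (rule assms(2))
  then have "B' - B = 0" unfolding eq by (simp add: linear_0[OF assms(1)])
  then show "B' = B" by simp
qed

lemma normal_part_conformal:
  assumes lin: "linear (frechet_derivative X (at x))"
    and su: "\<And>v. frechet_derivative X (at x) v \<in> su"
    and conf: "\<And>v w. frechet_derivative X (at x) v \<bullet> frechet_derivative X (at x) w = c * (v \<bullet> w)"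
    and c: "c \<noteq> 0" and A: "A \<in> su"
  obtains w where "normal_part X x A = A - frechet_derivative X (at x) w"
    "\<And>u. (A - frechet_derivative X (at x) w) \<bullet> frechet_derivative X (at x) u = 0"
proof -
  let ?D = "frechet_derivative X (at x)"
  \<comment> \<open>The vectors \<open>?D 1\<close> and \<open>?D \<i>\<close> are orthogonal with
    common squared length \<open>c\<close>, so these are the coefficients of the orthogonal
    projection of \<open>A\<close> onto the tangent plane.\<close>
  define w where "w = Complex (A \<bullet> ?D 1 / c) (A \<bullet> ?D \<i> / c)"
  have orth: "(A - ?D w) \<bullet> ?D u = 0" for u
  proof -
    have "?D u = ?D (Re u *\<^sub>R 1 + Im u *\<^sub>R \<i>)"
      by (rule arg_cong[OF complex_real_combination])
    also have "\<dots> = Re u *\<^sub>R ?D 1 + Im u *\<^sub>R ?D \<i>"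
      by (simp only: linear_add[OF lin] linear_scale[OF lin])
    finally have "A \<bullet> ?D u = Re u * (A \<bullet> ?D 1) + Im u * (A \<bullet> ?D \<i>)"
      by (simp add: inner_add_right)
    also have "\<dots> = c * (w \<bullet> u)" using c by (simp add: w_def inner_complex_def algebra_simps)
    finally show ?thesis by (simp add: inner_diff_left conf)
  qed
  have "normal_part X x A = A - ?D w"
  proof (rule normal_part_eqI[OF lin])
    fix v assume "su_inner (?D v) (?D v) = 0"
    then show "v = 0" using c by (simp add: su_inner_real su conf)
  qed (use orth su A in \<open>auto simp: su_inner_real su_diff\<close>)
  then show thesis using that orth by blast
qed

text \<open>Differentiate the two relations expressing conformality: the derivatives of
  \<open>Y\<close> along \<open>1\<close> and \<open>\<i>\<close> have equal length and are
  orthogonal. The factor \<open>c\<close> is eliminated beforehand, so no derivative of it appears.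
  Symmetry of the mixed derivative lets the mixed terms cancel in the product of the Laplacian with
  each tangent vector.\<close>

lemma conformal_laplacian_normal:
  fixes Y :: "complex \<Rightarrow> 'b::euclidean_space"
  assumes "open R" "C2_on R Y" "x \<in> R"
    and conf: "\<And>\<xi> v w. \<xi> \<in> R \<Longrightarrow>
       frechet_derivative Y (at \<xi>) v \<bullet> frechet_derivative Y (at \<xi>) w = c \<xi> * (v \<bullet> w)"
  defines "H \<equiv> \<lambda>u v. frechet_derivative (\<lambda>\<zeta>. frechet_derivative Y (at \<zeta>) v) (at x) u"
  shows "(H 1 1 + H \<i> \<i>) \<bullet> frechet_derivative Y (at x) u = 0"
proof -
  let ?D = "\<lambda>v \<zeta>. frechet_derivative Y (at \<zeta>) v"
  note d = C1_on_differentiable[OF C2_on_D[OF assms(2)] assms(3)]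
  have D: "frechet_derivative (\<lambda>\<zeta>. ?D v \<zeta> \<bullet> ?D w \<zeta>) (at x) u = ?D v x \<bullet> H u w + H u v \<bullet> ?D w x" for u v w
    unfolding H_def by (simp add: frechet_bounded_bilinear[OF bounded_bilinear_inner d d])
  have sym: "H 1 \<i> = H \<i> 1"
    unfolding H_def by (rule second_derivative_symmetric[OF assms(1-3)])
  have "frechet_derivative (\<lambda>\<zeta>. ?D 1 \<zeta> \<bullet> ?D 1 \<zeta>) (at x) = frechet_derivative (\<lambda>\<zeta>. ?D \<i> \<zeta> \<bullet> ?D \<i> \<zeta>) (at x)"
    by (rule frechet_cong_open[OF assms(1,3)]) (simp add: conf)
  from this[THEN fun_cong] have 1: "?D 1 x \<bullet> H u 1 = ?D \<i> x \<bullet> H u \<i>" for u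
    unfolding D by (simp add: inner_commute)
  have "frechet_derivative (\<lambda>\<zeta>. ?D 1 \<zeta> \<bullet> ?D \<i> \<zeta>) (at x) = frechet_derivative (\<lambda>\<zeta>. 0 :: real) (at x)"
    by (rule frechet_cong_open[OF assms(1,3)]) (simp add: conf inner_complex_def)
  from this[THEN fun_cong] have 2: "?D 1 x \<bullet> H u \<i> + ?D \<i> x \<bullet> H u 1 = 0" for u
    unfolding D by (simp add: inner_commute)
  have e: "(H 1 1 + H \<i> \<i>) \<bullet> w = w \<bullet> H 1 1 + w \<bullet> H \<i> \<i>" for w
    by (simp only: inner_commute[of "H 1 1 + H \<i> \<i>"] inner_add_right)
  have "(H 1 1 + H \<i> \<i>) \<bullet> ?D 1 x = 0"
    using 1[of 1] 2[of \<i>] unfolding e sym by linarith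
  moreover have "(H 1 1 + H \<i> \<i>) \<bullet> ?D \<i> x = 0"
    using 1[of \<i>] 2[of 1] unfolding e sym by linarith
  ultimately show ?thesis
    by (simp add: frechet_split[OF C2_on_differentiable[OF assms(2,3)], of u] inner_add_right)
qed

text \<open>Passing to normal parts subtracts tangent vectors \<open>?D w1\<close> and
  \<open>?D w2\<close>. Since the Laplacian is itself normal, their sum is both tangent and normal,
  hence zero. The second form therefore determines the full Laplacian of the surface.\<close>

lemma second_form_sum:
  assumes "open R" "C2_on R Y" "x \<in> R" "\<And>\<xi>. \<xi> \<in> R \<Longrightarrow> Y \<xi> \<in> su"
    and conf: "\<And>\<xi> v w. \<xi> \<in> R \<Longrightarrow>
       frechet_derivative Y (at \<xi>) v \<bullet> frechet_derivative Y (at \<xi>) w = c \<xi> * (v \<bullet> w)"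
    and c: "c x \<noteq> 0"
  shows "second_form Y x 1 + second_form Y x \<i> =
    frechet_derivative (\<lambda>\<zeta>. frechet_derivative Y (at \<zeta>) 1) (at x) 1
    + frechet_derivative (\<lambda>\<zeta>. frechet_derivative Y (at \<zeta>) \<i>) (at x) \<i>"
proof -
  define H where "H = (\<lambda>u v. frechet_derivative (\<lambda>\<zeta>. frechet_derivative Y (at \<zeta>) v) (at x) u)"
  let ?D = "frechet_derivative Y (at x)"
  have dsu: "frechet_derivative Y (at \<zeta>) v \<in> su" if "\<zeta> \<in> R" for \<zeta> v
    by (rule frechet_in_su[OF assms(1) C2_on_differentiable[OF assms(2) that] that assms(4)])
  have lin: "linear ?D" by (rule linear_frechet_derivative[OF C2_on_differentiable[OF assms(2,3)]])
  have Hsu: "H u v \<in> su" for u v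
    unfolding H_def
    by (rule frechet_in_su[OF assms(1) C1_on_differentiable[OF C2_on_D[OF assms(2)] assms(3)] assms(3) dsu])
  obtain w1 where w1: "normal_part Y x (H 1 1) = H 1 1 - ?D w1" "\<And>u. (H 1 1 - ?D w1) \<bullet> ?D u = 0"
    using normal_part_conformal[OF lin dsu[OF assms(3)] conf[OF assms(3)] c Hsu] by blast
  obtain w2 where w2: "normal_part Y x (H \<i> \<i>) = H \<i> \<i> - ?D w2" "\<And>u. (H \<i> \<i> - ?D w2) \<bullet> ?D u = 0"
    using normal_part_conformal[OF lin dsu[OF assms(3)] conf[OF assms(3)] c Hsu] by blast
  have lap: "(H 1 1 + H \<i> \<i>) \<bullet> ?D u = 0" for u
    unfolding H_def by (rule conformal_laplacian_normal[OF assms(1-3) conf])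
  have "?D (w1 + w2) \<bullet> ?D u = 0" for u
    using w1(2)[of u] w2(2)[of u] lap[of u]
    unfolding linear_add[OF lin] inner_diff_left inner_add_left by linarith
  then have "?D (w1 + w2) = 0" using inner_eq_zero_iff by blast
  then have "?D w2 = - ?D w1" by (simp add: linear_add[OF lin] add_eq_0_iff)
  then have "normal_part Y x (H 1 1) + normal_part Y x (H \<i> \<i>) = H 1 1 + H \<i> \<i>"
    unfolding w1(1) w2(1) by simp
  then show ?thesis by (simp add: second_form_def H_def)
qed

section \<open>Removable singularities\<close>

text \<open>Riemann's removable singularity theorem at each point of \<open>K\<close>. Carrying the
  pointwise bound \<open>B\<close> to the extension, by passing to the limit, is what makes the
  lemma applicable a second time.\<close>

lemma bounded_holomorphic_extension:
  assumes "open U" and K: "\<And>z. z \<in> U \<Longrightarrow> \<exists>r>0. \<forall>w\<in>ball z r. w \<noteq> z \<longrightarrow> w \<notin> K"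
    and h: "h holomorphic_on U - K" and B: "continuous_on U B"
    and le: "\<And>z. z \<in> U - K \<Longrightarrow> norm (h z) \<le> B z"
  obtains k where "k holomorphic_on U" "\<And>z. z \<in> U - K \<Longrightarrow> k z = h z" "\<And>z. z \<in> U \<Longrightarrow> norm (k z) \<le> B z"
proof -
  \<comment> \<open>A limit in place of a chosen local extension makes the local extensions agree
    automatically.\<close>
  define k where "k z = (if z \<in> K then Lim (at z) h else h z)" for z
  have loc: "\<exists>r>0. k holomorphic_on ball z r \<and> norm (k z) \<le> B z" if z: "z \<in> U" for z
  proof -
    obtain r1 where r1: "r1 > 0" "\<And>w. w \<in> ball z r1 \<Longrightarrow> w \<noteq> z \<Longrightarrow> w \<notin> K"
      using K[OF z] by blast
    obtain r2 where r2: "r2 > 0" "ball z r2 \<subseteq> U" using assms(1) z by (meson open_contains_ball)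
    define r where "r = min r1 r2"
    have r: "r > 0" "ball z r \<subseteq> U" "\<And>w. w \<in> ball z r - {z} \<Longrightarrow> w \<in> U - K"
      using r1 r2 by (auto simp: r_def)
    have hol: "h holomorphic_on ball z r - {z}"
      by (rule holomorphic_on_subset[OF h]) (use r(3) in blast)
    have ev: "\<forall>\<^sub>F w in at z. w \<in> ball z r - {z}"
      using eventually_at_ball[OF r(1), of z UNIV] by (auto simp: eventually_at_filter elim: eventually_mono)
    have Bc: "isCont B z" using B z assms(1) continuous_on_eq_continuous_at by blast
    then have "\<forall>\<^sub>F w in at z. B w < B z + 1"
      unfolding isCont_def by (rule order_tendstoD) simp
    \<comment> \<open>Near \<open>z\<close> the continuous bound stays below \<open>B z + 1\<close>,
      a constant, as removability requires.\<close>
    with ev have "\<forall>\<^sub>F w in at z. norm (h w) \<le> B z + 1"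
    proof eventually_elim
      case (elim w)
      then show ?case using le[OF r(3)[OF elim(1)]] by linarith
    qed
    then have "\<exists>g. g holomorphic_on ball z r \<and> (\<forall>w\<in>ball z r - {z}. g w = h w)"
      using holomorphic_on_extend_bounded[OF hol] r(1) by auto
    then obtain g where g: "g holomorphic_on ball z r" "\<And>w. w \<in> ball z r - {z} \<Longrightarrow> g w = h w" by blast
    have "isCont g z"
      using field_differentiable_imp_continuous_at[OF holomorphic_on_imp_differentiable_at[OF g(1) open_ball]] r(1)
      by simp
    then have "(g \<longlongrightarrow> g z) (at z)" by (simp add: isCont_def)
    then have lim: "(h \<longlongrightarrow> g z) (at z)"
      by (rule Lim_transform_eventually) (use ev g(2) in \<open>auto elim: eventually_mono\<close>)
    have kg: "k w = g w" if w: "w \<in> ball z r" for w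
    proof (cases "w = z")
      case True
      show ?thesis
      proof (cases "z \<in> K")
        case True
        then show ?thesis using \<open>w = z\<close> tendsto_Lim[OF _ lim] by (simp add: k_def)
      next
        case False
        \<comment> \<open>Here the whole ball avoids \<open>K\<close>, so \<open>h\<close> is
          already continuous at \<open>z\<close> and its value is the limit.\<close>
        then have "z \<in> U - K" using z by simp
        have hol': "h holomorphic_on ball z r"
          by (rule holomorphic_on_subset[OF h]) (use r(3) \<open>z \<in> U - K\<close> in blast)
        have "isCont h z"
          using field_differentiable_imp_continuous_at[OF holomorphic_on_imp_differentiable_at[OF hol' open_ball]] r(1)
          by simp
        then have "(h \<longlongrightarrow> h z) (at z)" by (simp add: isCont_def)
        then have "h z = g z" using lim tendsto_unique[OF at_neq_bot] by blast
        then show ?thesis using False \<open>w = z\<close> by (simp add: k_def)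
      qed
    next
      case False
      then show ?thesis using g(2)[of w] r(3)[of w] w by (simp add: k_def)
    qed
    have "k holomorphic_on ball z r"
      by (rule holomorphic_transform[OF g(1)]) (simp add: kg)
    moreover have "norm (g z) \<le> B z"
    proof (rule tendsto_le[OF at_neq_bot])
      show "(B \<longlongrightarrow> B z) (at z)" using Bc by (simp add: isCont_def)
      show "((\<lambda>w. norm (h w)) \<longlongrightarrow> norm (g z)) (at z)" by (rule tendsto_norm[OF lim])
      show "\<forall>\<^sub>F w in at z. norm (h w) \<le> B w" using ev le r(3) by (auto elim: eventually_mono)
    qed
    ultimately show ?thesis using r(1) kg[of z] by auto
  qed
  show thesis
  proof
    show "k holomorphic_on U"
      unfolding holomorphic_on_def
    proof
      fix z assume "z \<in> U"
      then obtain r where "r > 0" "k holomorphic_on ball z r" using loc by blast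
      then have "k field_differentiable at z"
        by (simp add: holomorphic_on_imp_differentiable_at)
      then show "k field_differentiable at z within U"
        by (rule field_differentiable_at_within)
    qed
    show "norm (k z) \<le> B z" if "z \<in> U" for z using loc[OF that] by blast
  qed (simp add: k_def)
qed

text \<open>The points of \<open>Z\<close> are isolated only relative to the complement of
  \<open>S\<close> and could accumulate at \<open>S\<close>. Hence they are filled in before
  \<open>S\<close>, after which only finitely many isolated singularities remain and the extension
  is an entire function tending to zero.\<close>

lemma holomorphic_vanishing:
  assumes "finite S" and Z: "\<And>z. z \<in> - S \<Longrightarrow> \<exists>r>0. \<forall>w\<in>ball z r. w \<noteq> z \<longrightarrow> w \<notin> Z"
    and h: "h holomorphic_on - S - Z" and B: "continuous_on UNIV B" "(B \<longlongrightarrow> (0::real)) at_infinity"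
    and le: "\<And>z. z \<in> - S - Z \<Longrightarrow> norm (h z) \<le> B z" and z: "z \<in> - S - Z"
  shows "h z = 0"
proof -
  have "open (- S)" using assms(1) by (simp add: finite_imp_closed open_Compl)
  then obtain k1 where k1: "k1 holomorphic_on - S" "\<And>z. z \<in> - S - Z \<Longrightarrow> k1 z = h z"
     "\<And>z. z \<in> - S \<Longrightarrow> norm (k1 z) \<le> B z"
    using bounded_holomorphic_extension[OF _ Z h continuous_on_subset[OF B(1) subset_UNIV] le] by blast
  have S: "\<exists>r>0. \<forall>w\<in>ball x r. w \<noteq> x \<longrightarrow> w \<notin> S" for x
  proof -
    obtain d where "d > 0" "\<forall>w\<in>S. w \<noteq> x \<longrightarrow> d \<le> dist x w"
      using finite_set_avoid[OF assms(1)] by blast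
    then show ?thesis by (intro exI[of _ d]) (auto simp: not_le[symmetric])
  qed
  have "k1 holomorphic_on UNIV - S" using k1(1) by (simp add: Compl_eq_Diff_UNIV)
  then obtain k2 where k2: "k2 holomorphic_on UNIV" "\<And>z. z \<in> UNIV - S \<Longrightarrow> k2 z = k1 z"
     "\<And>z. z \<in> UNIV \<Longrightarrow> norm (k2 z) \<le> B z"
    using bounded_holomorphic_extension[OF open_UNIV S _ B(1), of k1] k1(3) by auto
  have "(k2 \<longlongrightarrow> 0) at_infinity"
    by (rule Lim_null_comparison[OF _ B(2)]) (simp add: k2(3))
  then have "k2 z = 0" using Liouville_weak_0[OF k2(1)] by blast
  then show ?thesis using k1(2) k2(2) z by auto
qed

text \<open>In the chart at infinity the chain rule produces the factor
  \<open>- v / \<xi>\<^sup>2\<close>, which tends to zero, while the derivative in that chart stays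
  continuous at its origin.\<close>

lemma sphere_derivative_bound:
  fixes Q :: "complex \<Rightarrow> 'b::real_normed_vector"
  assumes "C2_on_sphere Q"
  shows "continuous_on UNIV (\<lambda>\<xi>. norm (frechet_derivative Q (at \<xi>) v))"
    "((\<lambda>\<xi>. norm (frechet_derivative Q (at \<xi>) v)) \<longlongrightarrow> 0) at_infinity"
proof -
  from assms have Q: "C2_on UNIV Q" by (simp add: C2_on_sphere_def)
  show "continuous_on UNIV (\<lambda>\<xi>. norm (frechet_derivative Q (at \<xi>) v))"
    by (intro continuous_on_norm C1_on_continuous C2_on_D Q)
  obtain Finf where F': "C2_on UNIV (\<lambda>w. if w = 0 then Finf else Q (inverse w))"
    using assms by (auto simp: C2_on_sphere_def)
  define F where "F = (\<lambda>w. if w = 0 then Finf else Q (inverse w))"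
  have F: "C2_on UNIV F" using F' by (simp add: F_def)
  \<comment> \<open>The value on \<open>v\<close> of the derivative of the inversion at
    \<open>\<xi>\<close>.\<close>
  define a where "a = (\<lambda>\<xi>::complex. - (inverse \<xi> * v * inverse \<xi>))"
  \<comment> \<open>Continuity in \<open>C2_on\<close> concerns fixed directions, so the moving
    direction \<open>a \<xi>\<close> is expanded in \<open>1\<close> and
    \<open>\<i>\<close>.\<close>
  define G where "G = (\<lambda>\<xi>. Re (a \<xi>) *\<^sub>R frechet_derivative F (at (inverse \<xi>)) 1
       + Im (a \<xi>) *\<^sub>R frechet_derivative F (at (inverse \<xi>)) \<i>)"
  have eq: "frechet_derivative Q (at \<xi>) v = G \<xi>" if "\<xi> \<noteq> 0" for \<xi>
  proof -
    have "frechet_derivative Q (at \<xi>) = frechet_derivative (\<lambda>\<xi>. F (inverse \<xi>)) (at \<xi>)"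
      by (rule frechet_cong_open[of "- {0}"]) (use that in \<open>auto simp: F_def\<close>)
    also have "\<dots> = (\<lambda>v. frechet_derivative F (at (inverse \<xi>)) (- (inverse \<xi> * v * inverse \<xi>)))"
      by (rule frechet_eqI, rule has_derivative_compose[OF Deriv.has_derivative_inverse[OF that has_derivative_ident]])
        (rule has_frechet[OF C2_on_differentiable[OF F]], simp)
    finally show ?thesis
      using frechet_split[OF C2_on_differentiable[OF F], of "inverse \<xi>" "a \<xi>"]
      by (simp add: G_def a_def)
  qed
  have inv: "(inverse \<longlongrightarrow> (0::complex)) at_infinity" by (rule tendsto_inverse_0)
  have a0: "(a \<longlongrightarrow> 0) at_infinity"
    unfolding a_def using tendsto_minus[OF tendsto_mult[OF tendsto_mult[OF inv tendsto_const] inv]] by simp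
  have lim: "((\<lambda>\<xi>. frechet_derivative F (at (inverse \<xi>)) u) \<longlongrightarrow> frechet_derivative F (at 0) u) at_infinity" for u
  proof (rule isCont_tendsto_compose[OF _ inv])
    show "isCont (\<lambda>w. frechet_derivative F (at w) u) 0"
      using C1_on_continuous[OF C2_on_D[OF F]] by (simp add: continuous_on_eq_continuous_at)
  qed
  have "(G \<longlongrightarrow> Re 0 *\<^sub>R frechet_derivative F (at 0) 1 + Im 0 *\<^sub>R frechet_derivative F (at 0) \<i>) at_infinity"
    unfolding G_def by (intro tendsto_add tendsto_scaleR tendsto_Re tendsto_Im a0 lim)
  then have "((\<lambda>\<xi>. norm (G \<xi>)) \<longlongrightarrow> 0) at_infinity" by (simp add: tendsto_norm_zero)
  then show "((\<lambda>\<xi>. norm (frechet_derivative Q (at \<xi>) v)) \<longlongrightarrow> 0) at_infinity"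
    by (rule Lim_transform_eventually)
      (use eventually_not_equal_at_infinity[of 0] in \<open>auto elim!: eventually_mono simp: eq\<close>)
qed

section \<open>Rigidity\<close>

text \<open>The function is twice the \<xi>-derivative of \<open>h\<close>. Its Cauchy-Riemann
  equations are the Laplace equation together with the symmetry of the mixed derivative.\<close>

lemma holomorphic_of_harmonic:
  assumes "open R" "C2_on R (h :: complex \<Rightarrow> complex)"
    and harm: "\<And>x. x \<in> R \<Longrightarrow> frechet_derivative (\<lambda>\<zeta>. frechet_derivative h (at \<zeta>) 1) (at x) 1
       + frechet_derivative (\<lambda>\<zeta>. frechet_derivative h (at \<zeta>) \<i>) (at x) \<i> = 0"
  shows "(\<lambda>\<zeta>. frechet_derivative h (at \<zeta>) 1 - \<i> * frechet_derivative h (at \<zeta>) \<i>) holomorphic_on R"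
  unfolding holomorphic_on_def
proof
  fix x assume x: "x \<in> R"
  define H where "H = (\<lambda>u v. frechet_derivative (\<lambda>\<zeta>. frechet_derivative h (at \<zeta>) v) (at x) u)"
  let ?W = "\<lambda>\<zeta>. frechet_derivative h (at \<zeta>) 1 - \<i> * frechet_derivative h (at \<zeta>) \<i>"
  note d = C1_on_differentiable[OF C2_on_D[OF assms(2)] x]
  have D: "(?W has_derivative (\<lambda>u. H u 1 - \<i> * H u \<i>)) (at x)"
    unfolding H_def by (intro has_derivative_diff has_derivative_mult_right has_frechet d)
  have sym: "H 1 \<i> = H \<i> 1"
    unfolding H_def by (rule second_derivative_symmetric[OF assms(1,2) x])
  have harm': "H 1 1 + H \<i> \<i> = 0" using harm[OF x] by (simp add: H_def)
  have split: "H u v = Re u *\<^sub>R H 1 v + Im u *\<^sub>R H \<i> v" for u v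
    unfolding H_def by (rule frechet_split[OF d])
  \<comment> \<open>The real differential turns out to be multiplication by one complex number,
    which is complex differentiability.\<close>
  have "H u 1 - \<i> * H u \<i> = (H 1 1 - \<i> * H 1 \<i>) * u" for u
  proof -
    have "H \<i> \<i> = - H 1 1" using harm' by (simp add: add_eq_0_iff)
    then show ?thesis
      unfolding split[of u 1] split[of u \<i>]
      by (simp add: sym[symmetric]) (simp add: complex_eq_iff algebra_simps)
  qed
  then have "(\<lambda>u. H u 1 - \<i> * H u \<i>) = (*) (H 1 1 - \<i> * H 1 \<i>)" by (rule ext)
  then have "(?W has_field_derivative (H 1 1 - \<i> * H 1 \<i>)) (at x)"
    using D by (simp add: has_field_derivative_def)
  then show "?W field_differentiable at x within R"
    using field_differentiable_at_within field_differentiable_def by blast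
qed

lemma su_isometry_norm:
  assumes "su_isometry L" "A \<in> su"
  shows "norm (L A) = norm A"
proof -
  have "L A \<in> su" using assms by (auto simp: su_isometry_def)
  then have "L A \<bullet> L A = A \<bullet> A"
    using assms su_inner_real[of "L A" "L A"] su_inner_real[of A A] by (simp add: su_isometry_def flip: of_real_divide)
  then show ?thesis by (simp add: norm_eq_sqrt_inner)
qed

text \<open>What has to be derived is \<open>dY = L dX\<close>, since \<open>L\<close> is tied to
  the second forms only. The first forms contribute twice: they make both parametrizations conformal
  with the same factor, and they give \<open>dY\<close> and \<open>L dX\<close> the same length,
  which bounds their difference by \<open>B\<close>.\<close>

lemma rigidity:
  fixes X Y :: "complex \<Rightarrow> complex^'n^'n"
  assumes "finite S" and Z: "\<And>z. z \<in> - S \<Longrightarrow> \<exists>r>0. \<forall>w\<in>ball z r. w \<noteq> z \<longrightarrow> w \<notin> Z"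
    and R: "R = - S - Z" "open R" "connected R"
    and X: "C2_on R X" "\<And>\<xi>. \<xi> \<in> R \<Longrightarrow> X \<xi> \<in> su"
    and Y: "C2_on R Y" "\<And>\<xi>. \<xi> \<in> R \<Longrightarrow> Y \<xi> \<in> su"
    and confX: "\<And>\<xi> v w. \<xi> \<in> R \<Longrightarrow>
       frechet_derivative X (at \<xi>) v \<bullet> frechet_derivative X (at \<xi>) w = c \<xi> * (v \<bullet> w)"
    and confY: "\<And>\<xi> v w. \<xi> \<in> R \<Longrightarrow>
       frechet_derivative Y (at \<xi>) v \<bullet> frechet_derivative Y (at \<xi>) w = c \<xi> * (v \<bullet> w)"
    and c: "\<And>\<xi>. \<xi> \<in> R \<Longrightarrow> c \<xi> \<noteq> 0"
    and L: "su_isometry L" "\<And>\<xi> v. \<xi> \<in> R \<Longrightarrow> second_form Y \<xi> v = L (second_form X \<xi> v)"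
    and B: "continuous_on UNIV B" "(B \<longlongrightarrow> 0) at_infinity"
      "\<And>\<xi>. \<xi> \<in> R \<Longrightarrow> norm (frechet_derivative X (at \<xi>) 1) + norm (frechet_derivative X (at \<xi>) \<i>) \<le> B \<xi>"
  shows "\<exists>C\<in>su. \<forall>\<xi>\<in>R. Y \<xi> = L (X \<xi>) + C"
proof -
  have linL: "linear L" using L by (simp add: su_isometry_def)
  then have bL: "bounded_linear L" by (simp add: linear_conv_bounded_linear)
  have Lsu: "A \<in> su \<Longrightarrow> L A \<in> su" for A using L(1) by (auto simp: su_isometry_def)
  define H where "H = (\<lambda>\<xi>. Y \<xi> - L (X \<xi>))"
  note dX = C2_on_differentiable[OF X(1)] and dY = C2_on_differentiable[OF Y(1)]
  note dX2 = C1_on_differentiable[OF C2_on_D[OF X(1)]] and dY2 = C1_on_differentiable[OF C2_on_D[OF Y(1)]]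
  have C2H: "C2_on R H"
    unfolding H_def by (intro C2_on_diff R(2) Y(1) C2_on_bounded_linear[OF R(2) bL] X(1))
  have Hsu: "H \<xi> \<in> su" if "\<xi> \<in> R" for \<xi>
    using that by (simp add: H_def su_diff Lsu X Y)
  have DH: "frechet_derivative H (at \<xi>) v = frechet_derivative Y (at \<xi>) v - L (frechet_derivative X (at \<xi>) v)"
    if "\<xi> \<in> R" for \<xi> v
    unfolding H_def
    by (simp add: frechet_diff[OF dY[OF that] frechet_bounded_linear(1)[OF bL dX[OF that]]]
        frechet_bounded_linear(2)[OF bL dX[OF that]])
  have D2H: "frechet_derivative (\<lambda>\<zeta>. frechet_derivative H (at \<zeta>) v) (at \<xi>) v =
     frechet_derivative (\<lambda>\<zeta>. frechet_derivative Y (at \<zeta>) v) (at \<xi>) v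
     - L (frechet_derivative (\<lambda>\<zeta>. frechet_derivative X (at \<zeta>) v) (at \<xi>) v)" if "\<xi> \<in> R" for \<xi> v
  proof -
    have "frechet_derivative (\<lambda>\<zeta>. frechet_derivative H (at \<zeta>) v) (at \<xi>) =
       frechet_derivative (\<lambda>\<zeta>. frechet_derivative Y (at \<zeta>) v - L (frechet_derivative X (at \<zeta>) v)) (at \<xi>)"
      by (rule frechet_cong_open[OF R(2) that]) (rule DH)
    then show ?thesis
      by (simp add: frechet_diff[OF dY2[OF that] frechet_bounded_linear(1)[OF bL dX2[OF that]]]
        frechet_bounded_linear(2)[OF bL dX2[OF that]])
  qed
  \<comment> \<open>For both surfaces the second forms on \<open>1\<close> and \<open>\<i>\<close>
    add up to the Laplacian, and linearity of \<open>L\<close> transports the sum.\<close>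
  have lap: "frechet_derivative (\<lambda>\<zeta>. frechet_derivative H (at \<zeta>) 1) (at \<xi>) 1
     + frechet_derivative (\<lambda>\<zeta>. frechet_derivative H (at \<zeta>) \<i>) (at \<xi>) \<i> = 0" if "\<xi> \<in> R" for \<xi>
    using second_form_sum[OF R(2) X(1) that X(2) confX c[OF that]]
      second_form_sum[OF R(2) Y(1) that Y(2) confY c[OF that]] L(2)[OF that]
    unfolding D2H[OF that] by (simp add: algebra_simps flip: linear_add[OF linL])
  \<comment> \<open>The complex analysis is scalar, so it is carried out entry by entry.\<close>
  have C2E: "C2_on R (\<lambda>\<xi>. H \<xi> $ a $ b)" for a b
    by (rule C2_on_bounded_linear[OF R(2) bounded_linear_entry C2H])
  have DE: "frechet_derivative (\<lambda>\<xi>. H \<xi> $ a $ b) (at \<xi>) v = frechet_derivative H (at \<xi>) v $ a $ b"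
    if "\<xi> \<in> R" for \<xi> v a b
    by (simp add: frechet_bounded_linear(2)[OF bounded_linear_entry C2_on_differentiable[OF C2H that]])
  have D2E: "frechet_derivative (\<lambda>\<zeta>. frechet_derivative (\<lambda>\<xi>. H \<xi> $ a $ b) (at \<zeta>) v) (at \<xi>) v
     = frechet_derivative (\<lambda>\<zeta>. frechet_derivative H (at \<zeta>) v) (at \<xi>) v $ a $ b" if "\<xi> \<in> R" for \<xi> v a b
  proof -
    have "frechet_derivative (\<lambda>\<zeta>. frechet_derivative (\<lambda>\<xi>. H \<xi> $ a $ b) (at \<zeta>) v) (at \<xi>)
      = frechet_derivative (\<lambda>\<zeta>. frechet_derivative H (at \<zeta>) v $ a $ b) (at \<xi>)"
      by (rule frechet_cong_open[OF R(2) that]) (rule DE)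
    then show ?thesis
      by (simp add: frechet_bounded_linear(2)[OF bounded_linear_entry C1_on_differentiable[OF C2_on_D[OF C2H] that]])
  qed
  have entry_le: "norm (A $ a $ b) \<le> norm A" for A :: "complex^'n^'n" and a b
    using Finite_Cartesian_Product.norm_nth_le[of "A $ a" b] Finite_Cartesian_Product.norm_nth_le[of A a]
    by (rule order_trans)
  have W0: "frechet_derivative H (at \<xi>) 1 $ a $ b - \<i> * frechet_derivative H (at \<xi>) \<i> $ a $ b = 0"
    if "\<xi> \<in> R" for \<xi> a b
  proof -
    let ?W = "\<lambda>\<zeta>. frechet_derivative (\<lambda>\<xi>. H \<xi> $ a $ b) (at \<zeta>) 1 - \<i> * frechet_derivative (\<lambda>\<xi>. H \<xi> $ a $ b) (at \<zeta>) \<i>"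
    have lapE: "frechet_derivative (\<lambda>\<zeta>. frechet_derivative (\<lambda>\<xi>. H \<xi> $ a $ b) (at \<zeta>) 1) (at x) 1
        + frechet_derivative (\<lambda>\<zeta>. frechet_derivative (\<lambda>\<xi>. H \<xi> $ a $ b) (at \<zeta>) \<i>) (at x) \<i> = 0" if "x \<in> R" for x
      unfolding D2E[OF that] using arg_cong[OF lap[OF that], of "\<lambda>A. A $ a $ b"] by simp
    have hol: "?W holomorphic_on - S - Z"
      using holomorphic_of_harmonic[OF R(2) C2E lapE] unfolding R(1) .
    have bound: "norm (?W z) \<le> 2 * B z" if z: "z \<in> - S - Z" for z
    proof -
      have zR: "z \<in> R" using z R(1) by simp
      \<comment> \<open>The factor 2 is the triangle inequality for two vectors, each as long as the
        derivative of \<open>X\<close>.\<close>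
      have n: "norm (frechet_derivative H (at z) v) \<le> 2 * norm (frechet_derivative X (at z) v)" for v
      proof -
        have "norm (frechet_derivative Y (at z) v) = norm (frechet_derivative X (at z) v)"
          by (simp add: norm_eq_sqrt_inner confX[OF zR] confY[OF zR])
        moreover have "norm (L (frechet_derivative X (at z) v)) = norm (frechet_derivative X (at z) v)"
          by (rule su_isometry_norm[OF L(1) frechet_in_su[OF R(2) dX[OF zR] zR X(2)]])
        ultimately show ?thesis
          unfolding DH[OF zR] using norm_triangle_ineq4[of "frechet_derivative Y (at z) v" "L (frechet_derivative X (at z) v)"]
          by simp
      qed
      have "norm (?W z) \<le> norm (frechet_derivative H (at z) 1 $ a $ b) + norm (frechet_derivative H (at z) \<i> $ a $ b)"
        unfolding DE[OF zR]
        using norm_triangle_ineq4[of "frechet_derivative H (at z) 1 $ a $ b" "\<i> * frechet_derivative H (at z) \<i> $ a $ b"]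
        by (simp add: norm_mult)
      then show ?thesis
        using entry_le[of "frechet_derivative H (at z) 1" a b] entry_le[of "frechet_derivative H (at z) \<i>" a b]
          n[of 1] n[of \<i>] B(3)[OF zR] by linarith
    qed
    have "?W \<xi> = 0"
    proof (rule holomorphic_vanishing[OF assms(1) Z hol _ _ bound])
      show "continuous_on UNIV (\<lambda>z. 2 * B z)" by (intro continuous_intros B)
      show "((\<lambda>z. 2 * B z) \<longlongrightarrow> 0) at_infinity" using tendsto_mult_left[OF B(2), of 2] by simp
    qed (use that R(1) in auto)
    then show ?thesis by (simp add: DE[OF that])
  qed
  have DH0: "frechet_derivative H (at \<xi>) v = 0" if "\<xi> \<in> R" for \<xi> v
  proof -
    let ?h = "\<lambda>v. frechet_derivative H (at \<xi>) v"
    have anti: "?h v $ b $ a = - cnj (?h v $ a $ b)" for v a b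
    proof -
      have "?h v \<in> su" by (rule frechet_in_su[OF R(2) C2_on_differentiable[OF C2H that] that Hsu])
      then have "cnj (?h v $ a $ b) = - ?h v $ b $ a" by (simp add: su_def flip: dagger_nth)
      then show ?thesis by simp
    qed
    \<comment> \<open>So far only the \<xi>-derivative of \<open>H\<close> vanishes. Its entry at
      the transposed position is related by conjugation, which turns the equation into the one for
      the conjugate derivative; together they kill both real derivatives.\<close>
    have e: "?h 1 $ a $ b = 0 \<and> ?h \<i> $ a $ b = 0" for a b
      using W0[OF that, of a b] W0[OF that, of b a] anti[of 1 a b] anti[of \<i> a b]
      by (auto simp: complex_eq_iff)
    then have "?h 1 = 0" "?h \<i> = 0" by (auto intro!: mat_eqI)
    then show ?thesis using frechet_split[OF C2_on_differentiable[OF C2H that], of v] by simp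
  qed
  show ?thesis
  proof (cases "R = {}")
    case True
    then show ?thesis using su_zero by auto
  next
    case False
    then obtain \<xi>0 where x0: "\<xi>0 \<in> R" by blast
    have "H \<xi> = H \<xi>0" if "\<xi> \<in> R" for \<xi>
    proof (rule has_derivative_zero_unique_connected[OF R(2,3) _ that x0])
      fix x assume x: "x \<in> R"
      show "(H has_derivative (\<lambda>x. 0)) (at x)"
        using has_frechet[OF C2_on_differentiable[OF C2H x]] DH0[OF x] by (simp add: ext[of "frechet_derivative H (at x)" "\<lambda>x. 0"])
    qed
    then have "\<forall>\<xi>\<in>R. Y \<xi> = L (X \<xi>) + H \<xi>0"
      by (simp add: H_def) (metis add.commute diff_add_cancel)
    then show ?thesis using Hsu[OF x0] by blast
  qed
qed

section \<open>The projector\<close>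

text \<open>This is \<open>x\<close> times the Hermitian conjugate of \<open>y\<close>. It expresses
  identities between vectors as identities between matrices, with \<open>y\<close> free. It is
  conjugate linear in \<open>y\<close>, so its bilinearity is over the reals.\<close>

definition outer :: "complex^'n \<Rightarrow> complex^'n \<Rightarrow> complex^'n^'n" where
  "outer x y = (\<chi> a b. x $ a * cnj (y $ b))"

lemma outer_nth: "outer x y $ a $ b = x $ a * cnj (y $ b)"
  by (simp add: outer_def)

lemma bounded_bilinear_outer: "bounded_bilinear (outer :: complex^'n \<Rightarrow> complex^'n \<Rightarrow> complex^'n^'n)"
  unfolding bilinear_conv_bounded_bilinear[symmetric] bilinear_def
  by (auto intro!: linearI mat_eqI simp: outer_nth algebra_simps)

lemma outer_zero: "outer 0 y = 0"
  by (rule mat_eqI) (simp add: outer_nth)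

lemma matmul_zero: "(0 :: complex^'n^'n) ** A = 0" "A ** (0 :: complex^'n^'n) = 0"
  by (simp_all add: vec_eq_iff matmul_nth)

lemma hdot_self: "hdot x x = of_real (x \<bullet> x)"
  by (simp add: hdot_def inner_vec_def complex_eq_iff inner_complex_def)

text \<open>A real scalar factor fits the real differential calculus and the lemma on inverses of
  real functions.\<close>

lemma projector_eq: "projector f \<xi> = mat 1 - inverse (f \<xi> \<bullet> f \<xi>) *\<^sub>R outer (f \<xi>) (f \<xi>)"
  by (rule mat_eqI) (simp add: projector_def hdot_self outer_nth, simp add: scaleR_conv_of_real divide_inverse)

lemma C2_on_projector:
  assumes "open U" "C2_on U f" "\<And>\<xi>. \<xi> \<in> U \<Longrightarrow> f \<xi> \<noteq> 0"
  shows "C2_on U (projector f)"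
proof -
  have "C2_on U (\<lambda>\<xi>. mat 1 - inverse (f \<xi> \<bullet> f \<xi>) *\<^sub>R outer (f \<xi>) (f \<xi>))"
    by (intro C2_on_diff[OF assms(1)] C2_on_const C2_on_bounded_bilinear[OF assms(1) bounded_bilinear_scaleR]
        C2_on_inverse[OF assms(1)] C2_on_bounded_bilinear[OF assms(1) bounded_bilinear_inner]
        C2_on_bounded_bilinear[OF assms(1) bounded_bilinear_outer] assms(2)) (use assms(3) in auto)
  then show ?thesis by (simp add: projector_eq[abs_def])
qed

lemma dagger_projector: "dagger (projector f \<xi>) = projector f \<xi>"
  by (rule mat_eqI) (auto simp: dagger_nth projector_eq outer_nth mat_def)

lemma trace_projector:
  fixes f :: "complex \<Rightarrow> complex^'n"
  assumes "f \<xi> \<noteq> 0"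
  shows "trace (projector f \<xi>) = of_nat CARD('n) - 1"
proof -
  have "trace (outer (f \<xi>) (f \<xi>)) = hdot (f \<xi>) (f \<xi>)"
    by (simp add: trace_def outer_nth hdot_def mult.commute)
  then show ?thesis using assms
    by (simp add: projector_eq trace_sub trace_I scaleR_eq_cscale trace_cscale hdot_self flip: of_real_mult)
qed

lemma projector_outer:
  assumes "f \<xi> \<noteq> 0"
  shows "projector f \<xi> ** outer (f \<xi>) y = 0"
proof -
  have "outer (f \<xi>) (f \<xi>) ** outer (f \<xi>) y = (f \<xi> \<bullet> f \<xi>) *\<^sub>R outer (f \<xi>) y"
  proof (rule mat_eqI)
    fix a b
    have "(outer (f \<xi>) (f \<xi>) ** outer (f \<xi>) y) $ a $ b = f \<xi> $ a * hdot (f \<xi>) (f \<xi>) * cnj (y $ b)"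
      by (simp add: matmul_nth outer_nth hdot_def sum_distrib_left sum_distrib_right mult_ac)
    then show "(outer (f \<xi>) (f \<xi>) ** outer (f \<xi>) y) $ a $ b = ((f \<xi> \<bullet> f \<xi>) *\<^sub>R outer (f \<xi>) y) $ a $ b"
      by (simp only: hdot_self vector_scaleR_component outer_nth) (simp add: scaleR_conv_of_real)
  qed
  then show ?thesis using assms
    by (simp add: projector_eq matmul_minus scaleR_eq_cscale matmul_cscale cscale_simps flip: of_real_mult)
qed

lemma mult_projector_eq:
  fixes f :: "complex \<Rightarrow> complex^'n" and A :: "complex^'n^'n"
  assumes "A ** outer (f \<xi>) (f \<xi>) = 0"
  shows "A ** projector f \<xi> = A"
  using assms by (simp add: projector_eq matmul_minus scaleR_eq_cscale matmul_cscale cscale_simps matrix_mul_rid)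

lemma projector_idem: "f \<xi> \<noteq> 0 \<Longrightarrow> projector f \<xi> ** projector f \<xi> = projector f \<xi>"
  by (intro mult_projector_eq projector_outer)

lemma mat_wirtinger_outer:
  assumes "f differentiable (at x)"
  shows "mat_wirtinger k (\<lambda>\<zeta>. outer (f \<zeta>) y) x = outer (vec_wirtinger k f x) y"
proof -
  interpret bounded_bilinear outer by (rule bounded_bilinear_outer)
  have "frechet_derivative (\<lambda>\<zeta>. f \<zeta> $ a) (at x) = (\<lambda>v. frechet_derivative f (at x) v $ a)" for a
    by (rule frechet_bounded_linear[OF bounded_linear_vec_nth assms])
  then show ?thesis
    by (intro mat_eqI)
      (simp add: mat_wirtinger_eq frechet_bounded_linear[OF bounded_linear_left assms] cscale_nth outer_nth
        vec_wirtinger_def wirtinger_eq algebra_simps)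
qed

text \<open>The product rule applied to \<open>P f = 0\<close>, with \<open>y\<close> held
  fixed.\<close>

lemma mat_wirtinger_projector_outer:
  assumes "open U" "C2_on U f" "\<And>\<xi>. \<xi> \<in> U \<Longrightarrow> f \<xi> \<noteq> 0" "x \<in> U"
  shows "mat_wirtinger k (projector f) x ** outer (f x) y = - (projector f x ** outer (vec_wirtinger k f x) y)"
proof -
  interpret bounded_bilinear outer by (rule bounded_bilinear_outer)
  note df = C2_on_differentiable[OF assms(2,4)]
  note dP = C2_on_differentiable[OF C2_on_projector[OF assms(1-3)] assms(4)]
  have "mat_wirtinger k (\<lambda>\<zeta>. projector f \<zeta> ** outer (f \<zeta>) y) x = mat_wirtinger k (\<lambda>\<zeta>. 0) x"
    by (rule mat_wirtinger_cong_open[OF assms(1,4)]) (simp add: projector_outer assms(3))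
  also have "\<dots> = 0" by (simp add: mat_wirtinger_eq cscale_simps)
  finally show ?thesis
    by (simp add: mat_wirtinger_mult[OF dP frechet_bounded_linear(1)[OF bounded_linear_left df]]
        mat_wirtinger_outer[OF df] add_eq_0_iff2)
qed

lemma projector_derivative:
  assumes "open U" "C2_on U f" "\<And>\<xi>. \<xi> \<in> U \<Longrightarrow> f \<xi> \<noteq> 0" "x \<in> U"
  shows "mat_wirtinger k (projector f) x ** projector f x + projector f x ** mat_wirtinger k (projector f) x
    = mat_wirtinger k (projector f) x"
proof -
  note dP = C2_on_differentiable[OF C2_on_projector[OF assms(1-3)] assms(4)]
  have "mat_wirtinger k (\<lambda>\<zeta>. projector f \<zeta> ** projector f \<zeta>) x = mat_wirtinger k (projector f) x"
    by (rule mat_wirtinger_cong_open[OF assms(1,4)]) (simp add: projector_idem assms(3))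
  then show ?thesis by (simp add: mat_wirtinger_mult[OF dP dP])
qed

text \<open>If the derivative \<open>A\<close> of \<open>P\<close> belongs to an index in which
  \<open>f\<close> is constant, then \<open>A f = 0\<close>, that is \<open>A P = A\<close>.
  Differentiating \<open>P\<^sup>2 = P\<close> leaves \<open>P A = 0\<close>. Adjoints reverse the
  order of the factors, so the other derivative obtains the opposite sign.\<close>

lemma projector_commutator:
  assumes "open U" "C2_on U f" "\<And>\<xi>. \<xi> \<in> U \<Longrightarrow> f \<xi> \<noteq> 0" "x \<in> U" "vec_wirtinger k f x = 0"
  shows "commutator (mat_wirtinger k (projector f) x) (projector f x) = mat_wirtinger k (projector f) x"
    "commutator (dagger (mat_wirtinger k (projector f) x)) (projector f x) = - dagger (mat_wirtinger k (projector f) x)"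
proof -
  let ?A = "mat_wirtinger k (projector f) x" and ?P = "projector f x"
  have "?A ** outer (f x) (f x) = 0"
    using mat_wirtinger_projector_outer[OF assms(1-4), of k "f x"] assms(5)
    by (simp add: outer_zero matmul_zero)
  then have 1: "?A ** ?P = ?A" by (rule mult_projector_eq)
  then have 2: "?P ** ?A = 0" using projector_derivative[OF assms(1-4), of k] by simp
  show "commutator ?A ?P = ?A" by (simp add: commutator_def 1 2)
  have "dagger ?A ** ?P = dagger (?P ** ?A)" "?P ** dagger ?A = dagger (?A ** ?P)"
    by (simp_all add: dagger_simps dagger_projector)
  then show "commutator (dagger ?A) ?P = - dagger ?A"
    by (simp add: commutator_def 1 2 dagger_simps)
qed

lemma dagger_wirtinger_hermitian:
  assumes "open U" "x \<in> U" "F differentiable (at x)" "\<And>y. y \<in> U \<Longrightarrow> dagger (F y) = F y"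
  shows "dagger (dM F x) = dbarM F x" "dagger (dbarM F x) = dM F x"
  unfolding dagger_mat_wirtinger[OF assms(3)]
  by (rule mat_wirtinger_cong_open[OF assms(1,2)], simp add: assms(4))+

section \<open>Critical points of the projector\<close>

lemma scalar_frechet_eq_wirtinger:
  fixes g :: "complex \<Rightarrow> complex"
  assumes "g differentiable (at x)"
  shows "frechet_derivative g (at x) v = v * wirtinger 1 g x + cnj v * wirtinger 2 g x"
  unfolding frechet_split[OF assms, of v] wirtinger_eq
  by (simp add: wsign_simps) (simp add: complex_eq_iff field_simps)

text \<open>When one Wirtinger derivative vanishes, the differential of \<open>g\<close>, or of its
  conjugate, is complex linear. The conjugates in the second part make the theory of holomorphic
  functions available to antiholomorphic maps.\<close>

lemma holomorphic_of_wirtinger: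
  assumes "open U" "\<And>x. x \<in> U \<Longrightarrow> g differentiable (at x)"
  shows "(\<And>x. x \<in> U \<Longrightarrow> wirtinger 2 g x = 0) \<Longrightarrow> g holomorphic_on U \<and> wirtinger 1 g holomorphic_on U"
    and "(\<And>x. x \<in> U \<Longrightarrow> wirtinger 1 g x = 0) \<Longrightarrow>
       (\<lambda>x. cnj (g x)) holomorphic_on U \<and> (\<lambda>x. cnj (wirtinger 2 g x)) holomorphic_on U"
proof -
  have gen: "h holomorphic_on U \<and> h' holomorphic_on U"
    if "\<And>x. x \<in> U \<Longrightarrow> (h has_field_derivative h' x) (at x)" for h h'
  proof -
    have "h holomorphic_on U"
      using that field_differentiable_at_within unfolding holomorphic_on_def field_differentiable_def by blast
    moreover from this have "h' holomorphic_on U"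
      by (rule holomorphic_transform[OF holomorphic_deriv[OF _ assms(1)]]) (simp add: DERIV_imp_deriv that)
    ultimately show ?thesis by simp
  qed
  {
    assume w: "\<And>x. x \<in> U \<Longrightarrow> wirtinger 2 g x = 0"
    show "g holomorphic_on U \<and> wirtinger 1 g holomorphic_on U"
    proof (rule gen)
      fix x assume x: "x \<in> U"
      have "frechet_derivative g (at x) = (*) (wirtinger 1 g x)"
        by (rule ext) (simp add: scalar_frechet_eq_wirtinger[OF assms(2)[OF x]] w x)
      then show "(g has_field_derivative wirtinger 1 g x) (at x)"
        using has_frechet[OF assms(2)[OF x]] by (simp add: has_field_derivative_def)
    qed
  }
  {
    assume w: "\<And>x. x \<in> U \<Longrightarrow> wirtinger 1 g x = 0"
    show "(\<lambda>x. cnj (g x)) holomorphic_on U \<and> (\<lambda>x. cnj (wirtinger 2 g x)) holomorphic_on U"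
    proof (rule gen)
      fix x assume x: "x \<in> U"
      have "(\<lambda>v. cnj (frechet_derivative g (at x) v)) = (*) (cnj (wirtinger 2 g x))"
        by (rule ext) (simp add: scalar_frechet_eq_wirtinger[OF assms(2)[OF x]] w x)
      then show "((\<lambda>x. cnj (g x)) has_field_derivative cnj (wirtinger 2 g x)) (at x)"
        using bounded_linear.has_derivative[OF bounded_linear_cnj has_frechet[OF assms(2)[OF x]]]
        by (simp add: has_field_derivative_def)
    qed
  }
qed

text \<open>The derivative of the projector vanishes where \<open>f\<close> and its derivative are linearly dependent,
  that is, where their two by two minors vanish.\<close>

lemma projector_critical_minors:
  assumes "open U" "C2_on U f" "\<And>\<xi>. \<xi> \<in> U \<Longrightarrow> f \<xi> \<noteq> 0" "x \<in> U"
    and comm: "commutator (mat_wirtinger k (projector f) x) (projector f x) = - mat_wirtinger k (projector f) x"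
  shows "mat_wirtinger k (projector f) x = 0 \<longleftrightarrow>
    (\<forall>i j. f x $ i * wirtinger k (\<lambda>\<zeta>. f \<zeta> $ j) x = f x $ j * wirtinger k (\<lambda>\<zeta>. f \<zeta> $ i) x)"
proof
  let ?A = "mat_wirtinger k (projector f) x" and ?P = "projector f x" and ?d = "vec_wirtinger k f x"
  have d: "wirtinger k (\<lambda>\<zeta>. f \<zeta> $ j) x = ?d $ j" for j by (simp add: vec_wirtinger_def)
  {
    assume "?A = 0"
    then have "?P ** outer ?d (\<chi> b. 1) = 0"
      using mat_wirtinger_projector_outer[OF assms(1-4), of k "\<chi> b. 1"] by (simp add: matmul_zero)
    then have z: "(?P ** outer ?d (\<chi> b. 1)) $ j $ j = 0" for j by simp
    \<comment> \<open>This is the coefficient of the orthogonal projection of the derivative of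
      \<open>f\<close> onto \<open>f\<close>. Because the second factor of \<open>outer\<close> has
      all entries 1, the diagonal of the matrix above is the remaining normal component.\<close>
    define s where "s = inverse (hdot (f x) (f x)) * hdot (f x) ?d"
    have "?d $ j = s * f x $ j" for j
    proof -
      have "(?P ** outer ?d (\<chi> b. 1)) $ j $ j = ?d $ j - s * f x $ j"
        by (simp add: projector_def matmul_nth outer_nth mat_def left_diff_distrib sum_subtractf
            if_distrib[of "\<lambda>c. c * _"] cong: if_cong)
          (simp add: s_def hdot_def sum_distrib_left sum_distrib_right divide_inverse mult_ac)
      then show ?thesis using z[of j] by simp
    qed
    then show "\<forall>i j. f x $ i * wirtinger k (\<lambda>\<zeta>. f \<zeta> $ j) x = f x $ j * wirtinger k (\<lambda>\<zeta>. f \<zeta> $ i) x"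
      unfolding d by simp
  }
  {
    assume m: "\<forall>i j. f x $ i * wirtinger k (\<lambda>\<zeta>. f \<zeta> $ j) x = f x $ j * wirtinger k (\<lambda>\<zeta>. f \<zeta> $ i) x"
    obtain i where i: "f x $ i \<noteq> 0" using assms(3)[OF assms(4)] by (auto simp: vec_eq_iff)
    define s where "s = ?d $ i / f x $ i"
    have "?d $ j = s * f x $ j" for j
      using m[rule_format, of i j] i unfolding d s_def by (simp add: field_simps)
    then have "outer ?d (f x) = s \<cdot>\<^sub>C outer (f x) (f x)"
      by (intro mat_eqI) (simp only: outer_nth cscale_nth mult.assoc)
    then have "?A ** outer (f x) (f x) = 0"
      using mat_wirtinger_projector_outer[OF assms(1-4), of k "f x"]
      by (simp add: matmul_cscale projector_outer assms(3,4) cscale_simps)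
    then have 1: "?A ** ?P = ?A" by (rule mult_projector_eq)
    then have "?P ** ?A = 0" using projector_derivative[OF assms(1-4), of k] by simp
    \<comment> \<open>Linear dependence makes the commutator equal to \<open>?A\<close>, as it is in
      the index where \<open>f\<close> is constant. Here \<open>comm\<close> prescribes the opposite
      sign.\<close>
    then have "?A = - ?A" using comm by (simp add: commutator_def 1)
    then have "2 *\<^sub>R ?A = 0" by (simp add: scaleR_2 eq_neg_iff_add_eq_0)
    then show "?A = 0" by simp
  }
qed

lemma zero_set_discrete:
  assumes "open U" "connected U" "M holomorphic_on U" "x0 \<in> U" "M x0 \<noteq> 0" "z \<in> U"
  shows "\<exists>r>0. \<forall>w\<in>ball z r. w \<noteq> z \<longrightarrow> M w \<noteq> 0"
proof (cases "M z = 0")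
  case True
  then show ?thesis
    using isolated_zeros[OF assms(3,1,2,6) True assms(4,5)] by (metis DiffI singletonD)
next
  case False
  have "isCont M z"
    using field_differentiable_imp_continuous_at[OF holomorphic_on_imp_differentiable_at[OF assms(3,1,6)]] .
  from continuous_at_avoid[OF this False]
  show ?thesis by (auto simp: mem_ball)
qed

text \<open>A minor that does not vanish at the noncritical point \<open>x0\<close> is a holomorphic
  function, not identically zero, whose zeros include every critical point. In the antiholomorphic
  case the conjugate minor is used, and hermiticity lets the two Wirtinger derivatives of
  \<open>P\<close> vanish together.\<close>

lemma projector_critical_discrete:
  assumes U: "open U" "connected U" and f: "C2_on U f" "\<And>\<xi>. \<xi> \<in> U \<Longrightarrow> f \<xi> \<noteq> 0"
    and hol: "holomorphic_vec U f \<or> antiholomorphic_vec U f"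
    and x0: "x0 \<in> U" "dM (projector f) x0 \<noteq> 0" and z: "z \<in> U"
  shows "\<exists>r>0. \<forall>w\<in>ball z r. w \<noteq> z \<longrightarrow> w \<in> U \<longrightarrow> dM (projector f) w \<noteq> 0"
proof -
  have dP: "projector f differentiable (at x)" if "x \<in> U" for x
    by (rule C2_on_differentiable[OF C2_on_projector[OF U(1) f] that])
  note dag = dagger_wirtinger_hermitian[OF U(1) _ dP dagger_projector]
  have iff: "dbarM (projector f) x = 0 \<longleftrightarrow> dM (projector f) x = 0" if "x \<in> U" for x
    using dag[OF that that] by (metis dagger_simps(7))
  have df: "(\<lambda>\<zeta>. f \<zeta> $ i) differentiable (at x)" if "x \<in> U" for x i
    by (rule frechet_bounded_linear[OF bounded_linear_vec_nth C2_on_differentiable[OF f(1) that]])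
  have "\<exists>M. M holomorphic_on U \<and> M x0 \<noteq> 0 \<and> (\<forall>x\<in>U. dM (projector f) x = 0 \<longrightarrow> M x = 0)"
    using hol
  proof
    assume h: "holomorphic_vec U f"
    have v: "vec_wirtinger 2 f x = 0" if "x \<in> U" for x using h that by (simp add: holomorphic_vec_def)
    then have w: "wirtinger 2 (\<lambda>\<zeta>. f \<zeta> $ i) x = 0" if "x \<in> U" for x i
      using that unfolding vec_wirtinger_def vec_eq_iff by simp
    have comm: "commutator (dM (projector f) x) (projector f x) = - dM (projector f) x" if "x \<in> U" for x
      using projector_commutator(2)[OF U(1) f that v[OF that]] dag(2)[OF that that] by simp
    have crit: "dM (projector f) x = 0 \<longleftrightarrow>
      (\<forall>i j. f x $ i * wirtinger 1 (\<lambda>\<zeta>. f \<zeta> $ j) x = f x $ j * wirtinger 1 (\<lambda>\<zeta>. f \<zeta> $ i) x)"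
      if "x \<in> U" for x
      by (rule projector_critical_minors[OF U(1) f that comm[OF that]])
    obtain i j where ij: "f x0 $ i * wirtinger 1 (\<lambda>\<zeta>. f \<zeta> $ j) x0 \<noteq> f x0 $ j * wirtinger 1 (\<lambda>\<zeta>. f \<zeta> $ i) x0"
      using crit[OF x0(1)] x0(2) by blast
    let ?M = "\<lambda>x. f x $ i * wirtinger 1 (\<lambda>\<zeta>. f \<zeta> $ j) x - f x $ j * wirtinger 1 (\<lambda>\<zeta>. f \<zeta> $ i) x"
    have "?M holomorphic_on U"
      using holomorphic_of_wirtinger(1)[OF U(1) df w] by (intro holomorphic_intros) auto
    moreover have "?M x0 \<noteq> 0" using ij by simp
    moreover have "?M x = 0" if "x \<in> U" "dM (projector f) x = 0" for x
      using crit[OF that(1)] that(2) by simp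
    ultimately show ?thesis by blast
  next
    assume h: "antiholomorphic_vec U f"
    have v: "vec_wirtinger 1 f x = 0" if "x \<in> U" for x using h that by (simp add: antiholomorphic_vec_def)
    then have w: "wirtinger 1 (\<lambda>\<zeta>. f \<zeta> $ i) x = 0" if "x \<in> U" for x i
      using that unfolding vec_wirtinger_def vec_eq_iff by simp
    have comm: "commutator (dbarM (projector f) x) (projector f x) = - dbarM (projector f) x" if "x \<in> U" for x
      using projector_commutator(2)[OF U(1) f that v[OF that]] dag(1)[OF that that] by simp
    have crit: "dbarM (projector f) x = 0 \<longleftrightarrow>
      (\<forall>i j. f x $ i * wirtinger 2 (\<lambda>\<zeta>. f \<zeta> $ j) x = f x $ j * wirtinger 2 (\<lambda>\<zeta>. f \<zeta> $ i) x)"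
      if "x \<in> U" for x
      by (rule projector_critical_minors[OF U(1) f that comm[OF that]])
    obtain i j where ij: "f x0 $ i * wirtinger 2 (\<lambda>\<zeta>. f \<zeta> $ j) x0 \<noteq> f x0 $ j * wirtinger 2 (\<lambda>\<zeta>. f \<zeta> $ i) x0"
      using crit[OF x0(1)] x0(2) iff[OF x0(1)] by blast
    let ?M = "\<lambda>x. cnj (f x $ i) * cnj (wirtinger 2 (\<lambda>\<zeta>. f \<zeta> $ j) x) - cnj (f x $ j) * cnj (wirtinger 2 (\<lambda>\<zeta>. f \<zeta> $ i) x)"
    have M: "?M x = cnj (f x $ i * wirtinger 2 (\<lambda>\<zeta>. f \<zeta> $ j) x - f x $ j * wirtinger 2 (\<lambda>\<zeta>. f \<zeta> $ i) x)" for x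
      by simp
    have "?M holomorphic_on U"
      using holomorphic_of_wirtinger(2)[OF U(1) df w] by (intro holomorphic_intros) auto
    moreover have "?M x0 \<noteq> 0" using ij unfolding M complex_cnj_zero_iff by simp
    moreover have "?M x = 0" if "x \<in> U" "dM (projector f) x = 0" for x
      unfolding M complex_cnj_zero_iff using crit[OF that(1)] iff[OF that(1)] that(2) by simp
    ultimately show ?thesis by blast
  qed
  then obtain M where M: "M holomorphic_on U" "M x0 \<noteq> 0" "\<And>x. x \<in> U \<Longrightarrow> dM (projector f) x = 0 \<Longrightarrow> M x = 0"
    by blast
  show ?thesis
    using zero_set_discrete[OF U M(1) x0(1) M(2) z] M(3) by blast
qed

section \<open>Line integrals, trace identities and the antidiagonal metric\<close>

lemma path_integral_derivative:
  fixes F :: "complex \<Rightarrow> 'b::banach"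
  assumes "valid_path \<gamma>" "\<And>x. x \<in> path_image \<gamma> \<Longrightarrow> F differentiable (at x)"
  shows "((\<lambda>t. frechet_derivative F (at (\<gamma> t)) (vector_derivative \<gamma> (at t within {0..1})))
     has_integral (F (pathfinish \<gamma>) - F (pathstart \<gamma>))) {0..1}"
proof -
  \<comment> \<open>\<open>K\<close> collects the corners of the piecewise smooth path, which the
    interior form of the fundamental theorem tolerates.\<close>
  obtain K where K: "finite K" "\<And>x. x \<in> {0..1} - K \<Longrightarrow> \<gamma> differentiable (at x within {0..1})"
    and c: "continuous_on {0..1} \<gamma>"
    using piecewise_C1_imp_differentiable[OF assms(1)[unfolded valid_path_def]]
    by (auto simp: piecewise_differentiable_on_def)
  have im: "\<gamma> t \<in> path_image \<gamma>" if "t \<in> {0..1}" for t using that by (simp add: path_image_def)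
  have "((\<lambda>t. frechet_derivative F (at (\<gamma> t)) (vector_derivative \<gamma> (at t within {0..1})))
     has_integral ((F \<circ> \<gamma>) 1 - (F \<circ> \<gamma>) 0)) {0..1}"
  proof (rule fundamental_theorem_of_calculus_interior_strong[OF K(1)])
    fix t assume t: "t \<in> {0<..<1} - K"
    then have at: "at t within {0..1} = at t" by (intro at_within_Icc_at) auto
    have "\<gamma> differentiable (at t)" using K(2)[of t] t at by auto
    then have "(\<gamma> has_vector_derivative vector_derivative \<gamma> (at t within {0..1})) (at t)"
      unfolding at by (simp add: vector_derivative_works)
    then show "((F \<circ> \<gamma>) has_vector_derivative frechet_derivative F (at (\<gamma> t)) (vector_derivative \<gamma> (at t within {0..1}))) (at t)"
      using vector_derivative_diff_chain_within[of \<gamma> _ t UNIV F "frechet_derivative F (at (\<gamma> t))"]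
        has_derivative_at_withinI[OF has_frechet[OF assms(2)[OF im]]] t by auto
  next
    have "continuous_on (\<gamma> ` {0..1}) F"
      using assms(2) by (auto simp: path_image_def intro!: continuous_at_imp_continuous_on differentiable_imp_continuous_within)
    then show "continuous_on {0..1} (F \<circ> \<gamma>)" by (rule continuous_on_compose[OF c])
  qed simp
  then show ?thesis by (simp add: pathfinish_def pathstart_def)
qed

lemma su_inner_cscale_sum:
  "su_inner (a \<cdot>\<^sub>C A) (b \<cdot>\<^sub>C B) = a * b * su_inner A B"
  by (simp add: su_inner_def matmul_cscale trace_cscale)

text \<open>Cyclicity annihilates the trace of \<open>A ** commutator A B\<close>. Applied to the
  Wirtinger derivatives of \<open>P\<close>, this removes the pure terms of the first form and is
  the source of conformality.\<close>

lemma trace_square_zero: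
  fixes A B :: "complex^'n^'n"
  assumes "commutator A B = c \<cdot>\<^sub>C A" "c \<noteq> 0"
  shows "trace (A ** A) = 0"
proof -
  have "c * trace (A ** A) = trace (A ** commutator A B)"
    by (simp add: assms matmul_cscale trace_cscale)
  also have "\<dots> = trace (A ** (A ** B)) - trace ((A ** B) ** A)"
    by (simp add: commutator_def matmul_minus trace_sub matrix_mul_assoc)
  also have "\<dots> = 0" using trace_mul_sym[of A "A ** B"] by simp
  finally show ?thesis using assms(2) by simp
qed

text \<open>The factor 2 compensates the one half in \<open>su_inner\<close>.\<close>

lemma conformal_of_first_form:
  fixes D :: "complex \<Rightarrow> complex^'n^'n"
  assumes "linear D" "\<And>v. D v \<in> su" "\<And>v. su_inner (D v) (D v) = c * v * cnj v"
  shows "D v \<bullet> D w = 2 * Re c * (v \<bullet> w)"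
proof (rule conformal_polarization[OF assms(1)])
  fix v
  have "of_real (D v \<bullet> D v / 2) = c * of_real ((norm v)\<^sup>2)"
    using assms(3)[of v] complex_norm_square[of v] by (simp add: su_inner_real assms(2) mult.assoc)
  then have "D v \<bullet> D v / 2 = Re (c * of_real ((norm v)\<^sup>2))" by (metis Re_complex_of_real)
  then show "D v \<bullet> D v = 2 * Re c * (norm v)\<^sup>2" by simp
qed

text \<open>\<open>matrix_inv\<close> is defined by choice, so the explicit inverse has to be shown
  unique. The shape is that of a conformal metric in the complex coordinates.\<close>

lemma matrix_inv_antidiagonal:
  fixes a :: complex
  assumes "a \<noteq> 0"
  shows "matrix_inv ((\<chi> i j. if i = j then 0 else a) :: complex^2^2) = (\<chi> i j. if i = j then 0 else 1 / a)"
proof -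
  let ?A = "(\<chi> i j. if i = j then 0 else a) :: complex^2^2" and ?B = "(\<chi> i j. if i = j then 0 else 1 / a) :: complex^2^2"
  have 1: "?A ** ?B = mat 1" "?B ** ?A = mat 1"
    using assms one_neq_two
    by (auto simp: vec_eq_iff forall_2 matrix_matrix_mult_def sum_2 mat_def)
  show ?thesis
    unfolding matrix_inv_def
  proof (rule some_equality)
    fix B assume "?A ** B = mat 1 \<and> B ** ?A = mat 1"
    then have "?B ** (?A ** B) = ?B" by (simp add: matrix_mul_rid)
    then show "B = ?B" by (simp add: matrix_mul_assoc 1 matrix_mul_lid)
  qed (use 1 in blast)
qed

section \<open>The associated surface\<close>

text \<open>All that the geometry retains from \<open>f\<close> is the pair of commutator relations,
  in which the holomorphic and antiholomorphic cases differ by \<epsilon> alone. The constant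
  \<open>C0\<close> leaves room both for the traceless normalization and for the integration
  constant of an arbitrary Weierstrass immersion.\<close>

locale sigma_surface =
  fixes U :: "complex set" and P X :: "complex \<Rightarrow> complex^'n^'n" and \<epsilon> :: complex and C0 :: "complex^'n^'n"
  assumes open_U: "open U"
    and C2_P: "C2_on U P"
    and hermitian: "\<xi> \<in> U \<Longrightarrow> dagger (P \<xi>) = P \<xi>"
    and commutator_dM: "\<xi> \<in> U \<Longrightarrow> commutator (dM P \<xi>) (P \<xi>) = - (\<epsilon> \<cdot>\<^sub>C dM P \<xi>)"
    and commutator_dbarM: "\<xi> \<in> U \<Longrightarrow> commutator (dbarM P \<xi>) (P \<xi>) = \<epsilon> \<cdot>\<^sub>C dbarM P \<xi>"
    and eps: "\<epsilon> = 1 \<or> \<epsilon> = - 1"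
    and X_eq: "\<xi> \<in> U \<Longrightarrow> X \<xi> = (\<epsilon> * \<i>) \<cdot>\<^sub>C P \<xi> + C0"
    and X_su: "\<xi> \<in> U \<Longrightarrow> X \<xi> \<in> su"
begin

abbreviation g :: "complex \<Rightarrow> complex" where "g \<xi> \<equiv> trace (dM P \<xi> ** dbarM P \<xi>)"

lemma eps_simps: "\<epsilon> * \<epsilon> = 1" "\<epsilon> * \<epsilon> * c = c" "\<epsilon> * (\<epsilon> * c) = c" "\<epsilon> \<noteq> 0"
  using eps by auto

lemma P_differentiable: "\<xi> \<in> U \<Longrightarrow> P differentiable (at \<xi>)"
  by (rule C2_on_differentiable[OF C2_P])

lemma C1_on_wirtinger_P: "C1_on U (mat_wirtinger k P)"
  by (rule C1_on_mat_wirtinger[OF open_U C2_P])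

lemma wirtinger_P_differentiable: "\<xi> \<in> U \<Longrightarrow> mat_wirtinger k P differentiable (at \<xi>)"
  by (rule C1_on_differentiable[OF C1_on_wirtinger_P])

lemma dagger_dM: "\<xi> \<in> U \<Longrightarrow> dagger (dM P \<xi>) = dbarM P \<xi>"
  and dagger_dbarM: "\<xi> \<in> U \<Longrightarrow> dagger (dbarM P \<xi>) = dM P \<xi>"
  using dagger_wirtinger_hermitian[OF open_U _ P_differentiable hermitian] by auto

lemma trace_dM_dM: "\<xi> \<in> U \<Longrightarrow> trace (dM P \<xi> ** dM P \<xi>) = 0"
  using commutator_dM eps_simps(4) by (intro trace_square_zero[where c = "- \<epsilon>"]) (auto simp: cscale_simps)

lemma trace_dbarM_dbarM: "\<xi> \<in> U \<Longrightarrow> trace (dbarM P \<xi> ** dbarM P \<xi>) = 0"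
  using commutator_dbarM eps_simps(4) by (intro trace_square_zero[where c = \<epsilon>]) auto

lemma X_differentiable: "\<xi> \<in> U \<Longrightarrow> X differentiable (at \<xi>)"
  and frechet_X: "\<xi> \<in> U \<Longrightarrow> frechet_derivative X (at \<xi>) v = (\<epsilon> * \<i>) \<cdot>\<^sub>C frechet_derivative P (at \<xi>) v"
  and wirtinger_X: "\<xi> \<in> U \<Longrightarrow> mat_wirtinger k X \<xi> = (\<epsilon> * \<i>) \<cdot>\<^sub>C mat_wirtinger k P \<xi>"
proof -
  assume x: "\<xi> \<in> U"
  note l = frechet_bounded_linear[OF bounded_linear_cscale P_differentiable[OF x], of "\<epsilon> * \<i>"]
  show dX: "X differentiable (at \<xi>)"
    by (subst differentiable_cong_open[OF open_U x, of X "\<lambda>\<zeta>. (\<epsilon> * \<i>) \<cdot>\<^sub>C P \<zeta> + C0"])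
      (auto simp: X_eq intro!: differentiable_add l(1))
  have frechet_X: "frechet_derivative X (at \<xi>) v = (\<epsilon> * \<i>) \<cdot>\<^sub>C frechet_derivative P (at \<xi>) v" for v
    by (subst frechet_cong_open[OF open_U x, of X "\<lambda>\<zeta>. (\<epsilon> * \<i>) \<cdot>\<^sub>C P \<zeta> + C0"])
      (simp_all add: X_eq frechet_add[OF l(1) differentiable_const] l(2))
  then show "frechet_derivative X (at \<xi>) v = (\<epsilon> * \<i>) \<cdot>\<^sub>C frechet_derivative P (at \<xi>) v" .
  show "mat_wirtinger k X \<xi> = (\<epsilon> * \<i>) \<cdot>\<^sub>C mat_wirtinger k P \<xi>"
    by (rule mat_eqI) (simp add: mat_wirtinger_eq[OF dX] mat_wirtinger_eq[OF P_differentiable[OF x]] frechet_X cscale_nth algebra_simps)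
qed

lemma C2_X: "C2_on U X"
  by (subst C2_on_cong[OF open_U, of X "\<lambda>\<zeta>. (\<epsilon> * \<i>) \<cdot>\<^sub>C P \<zeta> + C0"])
    (auto simp: X_eq intro!: C2_on_add C2_on_bounded_linear[OF _ bounded_linear_cscale] C2_on_const open_U C2_P)

lemma frechet_X_wirtinger:
  "\<xi> \<in> U \<Longrightarrow> frechet_derivative X (at \<xi>) v = (\<epsilon> * \<i>) \<cdot>\<^sub>C (v \<cdot>\<^sub>C dM P \<xi> + cnj v \<cdot>\<^sub>C dbarM P \<xi>)"
  by (simp add: frechet_X frechet_eq_wirtinger[OF P_differentiable])

lemma weierstrass_integral:
  assumes "valid_path \<gamma>" "path_image \<gamma> \<subseteq> U"
  shows "has_weierstrass_integral P \<gamma> (X (pathfinish \<gamma>) - X (pathstart \<gamma>))"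
proof -
  have "((\<lambda>t. frechet_derivative X (at (\<gamma> t)) (vector_derivative \<gamma> (at t within {0..1})))
     has_integral (X (pathfinish \<gamma>) - X (pathstart \<gamma>))) {0..1}"
    using assms(2) by (intro path_integral_derivative[OF assms(1)] X_differentiable) auto
  then show ?thesis
    unfolding has_weierstrass_integral_def
  proof (rule has_integral_eq[rotated])
    fix t :: real assume "t \<in> {0..1}"
    then have "\<gamma> t \<in> U" using assms(2) by (auto simp: path_image_def)
    then show "frechet_derivative X (at (\<gamma> t)) (vector_derivative \<gamma> (at t within {0..1})) =
      \<i> \<cdot>\<^sub>C (vector_derivative \<gamma> (at t within {0..1}) \<cdot>\<^sub>C - commutator (dM P (\<gamma> t)) (P (\<gamma> t)) +
        cnj (vector_derivative \<gamma> (at t within {0..1})) \<cdot>\<^sub>C commutator (dbarM P (\<gamma> t)) (P (\<gamma> t)))"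
      by (simp add: frechet_X_wirtinger commutator_dM commutator_dbarM cscale_simps mult_ac)
  qed
qed

text \<open>The square of \<open>\<epsilon> * \<i>\<close> is -1 and cancels the sign in
  \<open>su_inner\<close>; the pure terms have trace zero, and the two equal mixed terms absorb the
  factor one half.\<close>

lemma first_form_eq: "\<xi> \<in> U \<Longrightarrow> first_form X \<xi> v = g \<xi> * v * cnj v"
  using trace_mul_sym[of "dbarM P \<xi>" "dM P \<xi>"]
  by (simp add: first_form_def frechet_X_wirtinger su_inner_cscale_sum)
    (simp add: su_inner_def matmul_add matmul_cscale trace_add trace_cscale trace_dM_dM trace_dbarM_dbarM
      eps_simps algebra_simps)

lemma frechet_X_su: "\<xi> \<in> U \<Longrightarrow> frechet_derivative X (at \<xi>) v \<in> su"
  by (rule frechet_in_su[OF open_U X_differentiable _ X_su])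

lemma frechet_X_conformal:
  "\<xi> \<in> U \<Longrightarrow> frechet_derivative X (at \<xi>) v \<bullet> frechet_derivative X (at \<xi>) w = 2 * Re (g \<xi>) * (v \<bullet> w)"
  by (rule conformal_of_first_form[OF linear_frechet_derivative[OF X_differentiable] frechet_X_su])
    (auto simp: first_form_eq[unfolded first_form_def])

lemma g_real: "\<xi> \<in> U \<Longrightarrow> cnj (g \<xi>) = g \<xi>"
  by (simp add: dagger_simps dagger_dM dagger_dbarM flip: trace_dagger)

lemma Re_g_nonzero: "\<xi> \<in> U \<Longrightarrow> g \<xi> \<noteq> 0 \<Longrightarrow> Re (g \<xi>) \<noteq> 0"
  using g_real[of \<xi>] by (auto simp: complex_eq_iff)

text \<open>The squared length of every tangent vector is a multiple of the real part of
  \<open>g\<close>, so \<open>g = 0\<close> annihilates the whole differential of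
  \<open>X\<close>.\<close>

lemma g_eq_0_iff: "\<xi> \<in> U \<Longrightarrow> g \<xi> = 0 \<longleftrightarrow> dM P \<xi> = 0"
proof
  assume x: "\<xi> \<in> U" and "g \<xi> = 0"
  then have "frechet_derivative X (at \<xi>) v \<bullet> frechet_derivative X (at \<xi>) v = 0" for v
    by (simp add: frechet_X_conformal)
  then have "mat_wirtinger 1 X \<xi> = 0"
    by (simp add: mat_wirtinger_eq[OF X_differentiable[OF x]] cscale_simps)
  then show "dM P \<xi> = 0" using wirtinger_X[OF x, of 1] eps_simps(4) by (simp add: vec_eq_iff cscale_nth)
qed (simp add: matmul_zero trace_0[unfolded mat_0] trace_def)

lemma regular_points_eq: "regular_points U X = {\<xi>\<in>U. g \<xi> \<noteq> 0}"
proof -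
  have "inj (frechet_derivative X (at \<xi>)) \<longleftrightarrow> g \<xi> \<noteq> 0" if x: "\<xi> \<in> U" for \<xi>
  proof
    assume i: "inj (frechet_derivative X (at \<xi>))"
    show "g \<xi> \<noteq> 0"
    proof
      assume "g \<xi> = 0"
      then have "frechet_derivative X (at \<xi>) v = 0" for v
        using frechet_X_conformal[OF x, of v v] by simp
      then show False using injD[OF i, of 1 0] by simp
    qed
  next
    assume "g \<xi> \<noteq> 0"
    then have "frechet_derivative X (at \<xi>) v = 0 \<Longrightarrow> v = 0" for v
      using frechet_X_conformal[OF x, of v v] Re_g_nonzero[OF x] by auto
    then show "inj (frechet_derivative X (at \<xi>))"
      using linear_injective_0[OF linear_frechet_derivative[OF X_differentiable[OF x]]] by blast
  qed
  then show ?thesis by (auto simp: regular_points_def)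
qed

lemma open_regular: "open (regular_points U X)"
proof -
  have "continuous_on U g"
    by (intro bounded_bilinear.continuous_on[OF bounded_bilinear_trace_mult] C1_on_continuous C1_on_wirtinger_P)
  then have "open {\<xi>\<in>U. g \<xi> \<in> - {0}}"
    using continuous_open_preimage[OF _ open_U, of g "- {0}"] by (simp add: vimage_def Int_def open_Compl)
  then show ?thesis by (simp add: regular_points_eq)
qed

section \<open>Christoffel symbols and the second fundamental form\<close>

text \<open>Differentiate the two vanishing traces in both directions and use that the Wirtinger
  operators commute. In particular the mixed second derivative of \<open>P\<close> is orthogonal to
  the tangent plane, and each derivative of \<open>g\<close> reduces to a single term.\<close>

lemma trace_second:
  assumes x: "\<xi> \<in> U"
  shows "trace (dM (dM P) \<xi> ** dM P \<xi>) = 0"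
    "trace (dM (dbarM P) \<xi> ** dM P \<xi>) = 0"
    "trace (dM (dbarM P) \<xi> ** dbarM P \<xi>) = 0"
    "trace (dbarM (dbarM P) \<xi> ** dbarM P \<xi>) = 0"
    "wirtinger 1 g \<xi> = trace (dM (dM P) \<xi> ** dbarM P \<xi>)"
    "wirtinger 2 g \<xi> = trace (dbarM (dbarM P) \<xi> ** dM P \<xi>)"
proof -
  have sq: "trace (mat_wirtinger k (mat_wirtinger l P) \<xi> ** mat_wirtinger l P \<xi>) = 0"
    if z: "\<And>\<zeta>. \<zeta> \<in> U \<Longrightarrow> trace (mat_wirtinger l P \<zeta> ** mat_wirtinger l P \<zeta>) = 0" for k l
  proof -
    have "wirtinger k (\<lambda>\<zeta>. trace (mat_wirtinger l P \<zeta> ** mat_wirtinger l P \<zeta>)) \<xi> = wirtinger k (\<lambda>\<zeta>. 0) \<xi>"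
      by (rule wirtinger_cong_open[OF open_U x z])
    then show ?thesis
      using trace_mul_sym[of "mat_wirtinger k (mat_wirtinger l P) \<xi>" "mat_wirtinger l P \<xi>"]
      by (simp add: wirtinger_trace_mult[OF wirtinger_P_differentiable[OF x] wirtinger_P_differentiable[OF x]] wirtinger_const)
  qed
  note comm = mat_wirtinger_commute[OF open_U C2_P x]
  show 1: "trace (dM (dM P) \<xi> ** dM P \<xi>) = 0" by (rule sq[OF trace_dM_dM])
  show 2: "trace (dM (dbarM P) \<xi> ** dM P \<xi>) = 0" using sq[OF trace_dM_dM, of 2] unfolding comm .
  show 3: "trace (dM (dbarM P) \<xi> ** dbarM P \<xi>) = 0" by (rule sq[OF trace_dbarM_dbarM])
  show "trace (dbarM (dbarM P) \<xi> ** dbarM P \<xi>) = 0" by (rule sq[OF trace_dbarM_dbarM])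
  show "wirtinger 1 g \<xi> = trace (dM (dM P) \<xi> ** dbarM P \<xi>)"
    using 2 trace_mul_sym[of "dM P \<xi>" "dM (dbarM P) \<xi>"]
    by (simp add: wirtinger_trace_mult[OF wirtinger_P_differentiable[OF x] wirtinger_P_differentiable[OF x]])
  show "wirtinger 2 g \<xi> = trace (dbarM (dbarM P) \<xi> ** dM P \<xi>)"
    using 3 trace_mul_sym[of "dM P \<xi>" "dbarM (dbarM P) \<xi>"]
    by (simp add: wirtinger_trace_mult[OF wirtinger_P_differentiable[OF x] wirtinger_P_differentiable[OF x]] comm)
qed

lemma metric_eq: "\<xi> \<in> U \<Longrightarrow> metric X \<xi> = (\<chi> i j. if i = j then 0 else g \<xi> / 2)"
  using trace_mul_sym[of "dbarM P \<xi>" "dM P \<xi>"] one_neq_two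
  by (simp add: vec_eq_iff forall_2 metric_def wirtinger_X su_inner_cscale_sum)
    (simp add: su_inner_def trace_dM_dM trace_dbarM_dbarM eps_simps algebra_simps)

text \<open>The inverse metric admits only \<open>l \<noteq> k\<close>. For
  \<open>i \<noteq> j\<close> the two nonzero derivatives of the metric cancel; for
  \<open>i = j\<close> the term with the minus sign is zero and the other two survive only if
  \<open>i = k\<close>.\<close>

lemma christoffel_eq:
  assumes x: "\<xi> \<in> U" and nz: "g \<xi> \<noteq> 0"
  shows "christoffel X \<xi> k i j = (if i = j \<and> j = k then wirtinger k g \<xi> / g \<xi> else 0)"
proof -
  have "1 / (g \<xi> / 2) = 2 / g \<xi>" by simp
  then have inv: "matrix_inv (metric X \<xi>) = (\<chi> i j. if i = j then 0 else 2 / g \<xi>)"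
    unfolding metric_eq[OF x] using matrix_inv_antidiagonal[of "g \<xi> / 2"] nz by (simp only:) simp
  have w: "wirtinger k (\<lambda>\<zeta>. metric X \<zeta> $ i $ j) \<xi> = (if i = j then 0 else wirtinger k g \<xi> / 2)" for k i j
  proof -
    have "wirtinger k (\<lambda>\<zeta>. metric X \<zeta> $ i $ j) \<xi> = wirtinger k (\<lambda>\<zeta>. if i = j then 0 else g \<zeta> / 2) \<xi>"
      by (rule wirtinger_cong_open[OF open_U x]) (simp add: metric_eq)
    also have "\<dots> = (if i = j then 0 else wirtinger k g \<xi> / 2)"
    proof -
      have "g differentiable (at \<xi>)"
        by (rule frechet_bounded_bilinear(1)[OF bounded_bilinear_trace_mult wirtinger_P_differentiable[OF x] wirtinger_P_differentiable[OF x]])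
      then have "frechet_derivative (\<lambda>\<zeta>. g \<zeta> / 2) (at \<xi>) = (\<lambda>v. frechet_derivative g (at \<xi>) v / 2)"
        by (rule frechet_bounded_linear(2)[OF bounded_linear_divide])
      then show ?thesis by (auto simp: wirtinger_eq add_divide_distrib)
    qed
    finally show ?thesis .
  qed
  show ?thesis
    using nz one_neq_two exhaust_2[of i] exhaust_2[of j] exhaust_2[of k]
    by (auto simp: christoffel_def inv w sum_2)
qed

lemma second_derivative_X:
  assumes x: "\<xi> \<in> U"
  shows "frechet_derivative (\<lambda>\<zeta>. frechet_derivative X (at \<zeta>) v) (at \<xi>) v = (\<epsilon> * \<i>) \<cdot>\<^sub>C
    (v\<^sup>2 \<cdot>\<^sub>C dM (dM P) \<xi> + (2 * v * cnj v) \<cdot>\<^sub>C dM (dbarM P) \<xi> + (cnj v)\<^sup>2 \<cdot>\<^sub>C dbarM (dbarM P) \<xi>)"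
proof -
  have "frechet_derivative (\<lambda>\<zeta>. frechet_derivative X (at \<zeta>) v) (at \<xi>)
    = frechet_derivative (\<lambda>\<zeta>. (\<epsilon> * \<i>) \<cdot>\<^sub>C frechet_derivative P (at \<zeta>) v) (at \<xi>)"
    by (rule frechet_cong_open[OF open_U x]) (rule frechet_X)
  then show ?thesis
    by (simp add: frechet_bounded_linear(2)[OF bounded_linear_cscale C1_on_differentiable[OF C2_on_D[OF C2_P] x]]
      second_derivative_eq_wirtinger[OF open_U C2_P x])
qed

text \<open>The numbers \<open>a\<close> and \<open>b\<close> are the tangential coefficients of the
  two pure second derivatives, read off from their traces against the opposite first derivative. The
  mixed derivative needs no correction, being normal already.\<close>

lemma second_form_eq:
  assumes x: "\<xi> \<in> U" and nz: "g \<xi> \<noteq> 0"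
  defines "a \<equiv> wirtinger 1 g \<xi> / g \<xi>" and "b \<equiv> wirtinger 2 g \<xi> / g \<xi>"
  shows "second_form X \<xi> v = (\<epsilon> * \<i>) \<cdot>\<^sub>C
    (v\<^sup>2 \<cdot>\<^sub>C (dM (dM P) \<xi> - a \<cdot>\<^sub>C dM P \<xi>) + (2 * v * cnj v) \<cdot>\<^sub>C dM (dbarM P) \<xi>
      + (cnj v)\<^sup>2 \<cdot>\<^sub>C (dbarM (dbarM P) \<xi> - b \<cdot>\<^sub>C dbarM P \<xi>))"
    (is "_ = ?B")
proof -
  have "dagger (dM (dM P) \<xi>) = dbarM (\<lambda>\<zeta>. dagger (dM P \<zeta>)) \<xi>"
    by (rule dagger_mat_wirtinger(1)[OF wirtinger_P_differentiable[OF x]])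
  also have "\<dots> = dbarM (dbarM P) \<xi>"
    by (rule mat_wirtinger_cong_open[OF open_U x dagger_dM])
  finally have dag: "dagger (dM (dM P) \<xi>) = dbarM (dbarM P) \<xi>" .
  have "cnj (wirtinger 1 g \<xi>) = trace (dM P \<xi> ** dbarM (dbarM P) \<xi>)"
    using x by (simp add: trace_second dagger_simps dag dagger_dbarM flip: trace_dagger)
  also have "\<dots> = wirtinger 2 g \<xi>" using x by (simp add: trace_second trace_mul_sym[of "dM P \<xi>"])
  \<comment> \<open>This relation makes the subtracted combination an actual value of the
    differential of \<open>X\<close>, at the direction \<open>v\<^sup>2 * a\<close>, and not merely
    a complex combination of tangent vectors.\<close>
  finally have ab: "cnj a = b" using g_real[OF x] by (simp add: a_def b_def)
  have "a * g \<xi> = wirtinger 1 g \<xi>" "b * g \<xi> = wirtinger 2 g \<xi>"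
    using nz by (auto simp: a_def b_def)
  then have t: "trace (dM (dM P) \<xi> ** dbarM P \<xi>) = a * g \<xi>" "trace (dbarM (dbarM P) \<xi> ** dM P \<xi>) = b * g \<xi>"
    "trace (dbarM P \<xi> ** dM P \<xi>) = g \<xi>"
    using trace_second(5,6)[OF x] trace_mul_sym[of "dbarM P \<xi>" "dM P \<xi>"] by simp_all
  show ?thesis
    unfolding second_form_def second_derivative_X[OF x]
  proof (rule normal_part_eqI)
    show "linear (frechet_derivative X (at \<xi>))"
      by (rule linear_frechet_derivative[OF X_differentiable[OF x]])
    show "w = 0" if "su_inner (frechet_derivative X (at \<xi>) w) (frechet_derivative X (at \<xi>) w) = 0" for w
      using that first_form_eq[OF x, of w] nz by (simp add: first_form_def)
    show "(\<epsilon> * \<i>) \<cdot>\<^sub>C (v\<^sup>2 \<cdot>\<^sub>C dM (dM P) \<xi> + (2 * v * cnj v) \<cdot>\<^sub>C dM (dbarM P) \<xi> + (cnj v)\<^sup>2 \<cdot>\<^sub>C dbarM (dbarM P) \<xi>)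
      - ?B \<in> range (frechet_derivative X (at \<xi>))"
    proof (rule range_eqI)
      show "(\<epsilon> * \<i>) \<cdot>\<^sub>C (v\<^sup>2 \<cdot>\<^sub>C dM (dM P) \<xi> + (2 * v * cnj v) \<cdot>\<^sub>C dM (dbarM P) \<xi> + (cnj v)\<^sup>2 \<cdot>\<^sub>C dbarM (dbarM P) \<xi>)
        - ?B = frechet_derivative X (at \<xi>) (v\<^sup>2 * a)"
        unfolding frechet_X_wirtinger[OF x] complex_cnj_mult complex_cnj_power ab
        by (rule mat_eqI) (simp add: cscale_nth algebra_simps)
    qed
    show "su_inner ?B (frechet_derivative X (at \<xi>) u) = 0" for u
      unfolding frechet_X_wirtinger[OF x] su_inner_cscale_sum
      by (simp add: su_inner_def matmul_add matmul_minus matmul_cscale trace_add trace_sub trace_cscale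
        trace_second(1-4)[OF x] trace_dM_dM[OF x] trace_dbarM_dbarM[OF x] t)
  qed
qed

section \<open>Fundamental forms and Euclidean motions\<close>

text \<open>The translation disappears on differentiation, and \<open>L\<close> preserves
  \<open>su_inner\<close>, hence takes tangent vectors to tangent vectors and normal parts to normal
  parts. The linear part itself is the witness for the second forms.\<close>

lemma euclidean_motion_same_forms:
  assumes T: "su_isometry L" "C \<in> su"
    and Y: "\<And>\<xi>. \<xi> \<in> regular_points U X \<Longrightarrow> Y \<xi> = L (X \<xi>) + C"
  shows "same_fundamental_forms (regular_points U X) X Y"
proof -
  let ?R = "regular_points U X"
  have linL: "linear L" using T by (simp add: su_isometry_def)
  then have bL: "bounded_linear L" by (simp add: linear_conv_bounded_linear)
  have inn: "su_inner (L A) (L B) = su_inner A B" if "A \<in> su" "B \<in> su" for A B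
    using T that by (simp add: su_isometry_def)
  have RU: "\<xi> \<in> U" "g \<xi> \<noteq> 0" if "\<xi> \<in> ?R" for \<xi> using that by (auto simp: regular_points_eq)
  have DY: "frechet_derivative Y (at \<xi>) v = L (frechet_derivative X (at \<xi>) v)" if x: "\<xi> \<in> ?R" for \<xi> v
  proof -
    note l = frechet_bounded_linear[OF bL X_differentiable[OF RU(1)[OF x]]]
    show ?thesis
      using frechet_cong_open[OF open_regular x Y]
      by (simp add: frechet_add[OF l(1) differentiable_const] l(2))
  qed
  have D2Y: "frechet_derivative (\<lambda>\<zeta>. frechet_derivative Y (at \<zeta>) v) (at \<xi>) v =
    L (frechet_derivative (\<lambda>\<zeta>. frechet_derivative X (at \<zeta>) v) (at \<xi>) v)" if x: "\<xi> \<in> ?R" for \<xi> v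
  proof -
    have "frechet_derivative (\<lambda>\<zeta>. frechet_derivative Y (at \<zeta>) v) (at \<xi>)
      = frechet_derivative (\<lambda>\<zeta>. L (frechet_derivative X (at \<zeta>) v)) (at \<xi>)"
      by (rule frechet_cong_open[OF open_regular x DY])
    then show ?thesis
      by (simp add: frechet_bounded_linear(2)[OF bL C1_on_differentiable[OF C2_on_D[OF C2_X] RU(1)[OF x]]])
  qed
  have I: "first_form Y \<xi> v = first_form X \<xi> v" if x: "\<xi> \<in> ?R" for \<xi> v
    by (simp add: first_form_def DY[OF x] inn frechet_X_su[OF RU(1)[OF x]])
  have II: "second_form Y \<xi> v = L (second_form X \<xi> v)" if x: "\<xi> \<in> ?R" for \<xi> v
  proof -
    let ?D = "frechet_derivative X (at \<xi>)"
    let ?A = "frechet_derivative (\<lambda>\<zeta>. frechet_derivative X (at \<zeta>) v) (at \<xi>) v"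
    have lin: "linear ?D" by (rule linear_frechet_derivative[OF X_differentiable[OF RU(1)[OF x]]])
    have A: "?A \<in> su"
      by (rule frechet_in_su[OF open_U C1_on_differentiable[OF C2_on_D[OF C2_X] RU(1)[OF x]] RU(1)[OF x] frechet_X_su])
    have c: "2 * Re (g \<xi>) \<noteq> 0" using Re_g_nonzero[OF RU[OF x]] by simp
    obtain w where w: "normal_part X \<xi> ?A = ?A - ?D w" "\<And>u. (?A - ?D w) \<bullet> ?D u = 0"
      using normal_part_conformal[OF lin frechet_X_su[OF RU(1)[OF x]] frechet_X_conformal[OF RU(1)[OF x]] c A] by blast
    have "normal_part Y \<xi> (L ?A) = L (?A - ?D w)"
    proof (rule normal_part_eqI)
      have "frechet_derivative Y (at \<xi>) = (\<lambda>v. L (?D v))" by (rule ext) (rule DY[OF x])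
      then show "linear (frechet_derivative Y (at \<xi>))"
        using linear_compose[OF lin linL] by (simp add: o_def)
      show "u = 0" if "su_inner (frechet_derivative Y (at \<xi>) u) (frechet_derivative Y (at \<xi>) u) = 0" for u
        using that I[OF x, of u] first_form_eq[OF RU(1)[OF x], of u] RU(2)[OF x] by (simp add: first_form_def)
      show "L ?A - L (?A - ?D w) \<in> range (frechet_derivative Y (at \<xi>))"
        by (rule range_eqI[of _ _ w]) (simp add: DY[OF x] linear_diff[OF linL])
      show "su_inner (L (?A - ?D w)) (frechet_derivative Y (at \<xi>) u) = 0" for u
        using w(2)[of u] by (simp add: DY[OF x] inn su_diff A frechet_X_su[OF RU(1)[OF x]] su_inner_real)
    qed
    then show ?thesis by (simp add: second_form_def D2Y[OF x] w(1))
  qed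
  show ?thesis unfolding same_fundamental_forms_def using I II T(1) by blast
qed


text \<open>For \<open>\<Gamma> 2 1 1\<close> and \<open>\<Gamma> 1 2 2\<close> both sides are zero,
  because the traces in the numerators vanish.\<close>

lemma christoffel_traces:
  assumes x: "\<xi> \<in> U" and nz: "g \<xi> \<noteq> 0"
  defines "\<Gamma> \<equiv> christoffel X \<xi>"
  shows "\<Gamma> 1 1 1 = trace (dM (dM P) \<xi> ** dbarM P \<xi>) / g \<xi>"
    "\<Gamma> 2 1 1 = trace (dM (dM P) \<xi> ** dM P \<xi>) / g \<xi>"
    "\<Gamma> 1 1 2 = 0" "\<Gamma> 1 2 1 = 0"
    "\<Gamma> 1 2 2 = trace (dbarM (dbarM P) \<xi> ** dbarM P \<xi>) / g \<xi>"
    "\<Gamma> 2 2 2 = trace (dbarM (dbarM P) \<xi> ** dM P \<xi>) / g \<xi>"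
    "\<Gamma> 2 1 2 = 0" "\<Gamma> 2 2 1 = 0"
  using one_neq_two by (simp_all add: \<Gamma>_def christoffel_eq[OF x nz] trace_second[OF x])

lemma second_form_christoffel:
  assumes x: "\<xi> \<in> U" and nz: "g \<xi> \<noteq> 0"
  defines "\<Gamma> \<equiv> christoffel X \<xi>"
  shows "second_form X \<xi> v = (\<epsilon> * \<i>) \<cdot>\<^sub>C
    (v\<^sup>2 \<cdot>\<^sub>C (dM (dM P) \<xi> - \<Gamma> 1 1 1 \<cdot>\<^sub>C dM P \<xi> - \<Gamma> 2 1 1 \<cdot>\<^sub>C dbarM P \<xi>)
     + (2 * v * cnj v) \<cdot>\<^sub>C dM (dbarM P) \<xi>
     + (cnj v)\<^sup>2 \<cdot>\<^sub>C (dbarM (dbarM P) \<xi> - \<Gamma> 1 2 2 \<cdot>\<^sub>C dM P \<xi> - \<Gamma> 2 2 2 \<cdot>\<^sub>C dbarM P \<xi>))"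
  using one_neq_two
  by (simp add: \<Gamma>_def christoffel_eq[OF x nz] second_form_eq[OF x nz] cscale_simps)

text \<open>Prepares the data for \<open>rigidity\<close>: isolated critical points, a connected
  regular set, and a bound \<open>B\<close> defined on the whole plane that decays at
  infinity.\<close>

lemma same_forms_euclidean_motion:
  fixes Y :: "complex \<Rightarrow> complex^'n^'n"
  assumes S: "finite S" "U = - S" and U: "connected U"
    and discrete: "\<And>x0 z. x0 \<in> U \<Longrightarrow> dM P x0 \<noteq> 0 \<Longrightarrow> z \<in> U \<Longrightarrow>
       \<exists>r>0. \<forall>w\<in>ball z r. w \<noteq> z \<longrightarrow> w \<in> U \<longrightarrow> dM P w \<noteq> 0"
    and Q: "C2_on_sphere Q" "\<And>\<xi>. \<xi> \<in> U \<Longrightarrow> Q \<xi> = P \<xi>"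
    and Y: "C2_on (regular_points U X) Y" "Y ` regular_points U X \<subseteq> su"
    and same: "same_fundamental_forms (regular_points U X) X Y"
  shows "\<exists>T. euclidean_motion T \<and> (\<forall>\<xi>\<in>regular_points U X. Y \<xi> = T (X \<xi>))"
proof -
  let ?R = "regular_points U X"
  define Z where "Z = {\<xi>\<in>U. g \<xi> = 0}"
  have R_eq: "?R = U - Z" by (auto simp: regular_points_eq Z_def)
  have RU: "\<xi> \<in> U" "g \<xi> \<noteq> 0" if "\<xi> \<in> ?R" for \<xi> using that by (auto simp: regular_points_eq)
  obtain L where L: "su_isometry L" "\<And>\<xi> v. \<xi> \<in> ?R \<Longrightarrow> second_form Y \<xi> v = L (second_form X \<xi> v)"
    and I: "\<And>\<xi> v. \<xi> \<in> ?R \<Longrightarrow> first_form Y \<xi> v = first_form X \<xi> v"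
    using same unfolding same_fundamental_forms_def by blast
  have "\<exists>C\<in>su. \<forall>\<xi>\<in>?R. Y \<xi> = L (X \<xi>) + C"
  \<comment> \<open>With an empty regular set, as for constant \<open>P\<close>, nothing has to be
    matched. Otherwise a noncritical point exists, which \<open>discrete\<close> takes as its
    starting point.\<close>
  proof (cases "?R = {}")
    case True
    then show ?thesis using su_zero by auto
  next
    case False
    then obtain x0 where x0: "x0 \<in> U" "dM P x0 \<noteq> 0"
      using g_eq_0_iff by (auto simp: regular_points_eq)
    have isolated: "\<exists>r>0. \<forall>w\<in>ball z r. w \<noteq> z \<longrightarrow> w \<notin> Z" if "z \<in> U" for z
      using discrete[OF x0 that] g_eq_0_iff unfolding Z_def by blast
    have "Z sparse_in U"
      unfolding sparse_in_eventually_iff[OF open_U]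
    proof
      fix z assume "z \<in> U"
      then obtain r where r: "r > 0" "\<forall>w\<in>ball z r. w \<noteq> z \<longrightarrow> w \<notin> Z" using isolated by blast
      show "\<forall>\<^sub>F w in at z. w \<notin> Z"
        unfolding eventually_at using r by (intro exI[of _ r]) (auto simp: dist_commute)
    qed
    \<comment> \<open>Removing a sparse set does not disconnect a connected open subset of the
      plane; this is what permits a single constant on the whole regular set.\<close>
    then have conn: "connected ?R"
      unfolding R_eq by (intro sparse_imp_connected U open_U) simp_all
    obtain K where K: "\<And>A. norm ((\<epsilon> * \<i>) \<cdot>\<^sub>C A :: complex^'n^'n) \<le> norm A * K"
      using bounded_linear.bounded[OF bounded_linear_cscale[of "\<epsilon> * \<i>"]] by blast
    \<comment> \<open>\<open>Q\<close> replaces \<open>P\<close> because its derivatives are defined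
      and continuous across \<open>S\<close> and tend to zero at infinity; \<open>K\<close> bounds
      multiplication by \<open>\<epsilon> * \<i>\<close>.\<close>
    define B where "B = (\<lambda>\<xi>. (norm (frechet_derivative Q (at \<xi>) 1) + norm (frechet_derivative Q (at \<xi>) \<i>)) * K)"
    have DP: "frechet_derivative P (at \<xi>) = frechet_derivative Q (at \<xi>)" if "\<xi> \<in> U" for \<xi>
      by (rule frechet_cong_open[OF open_U that]) (simp add: Q(2))
    show ?thesis
    proof (rule rigidity[OF S(1) _ _ open_regular conn, where Z = Z and X = X and Y = Y and L = L and c = "\<lambda>\<xi>. 2 * Re (g \<xi>)" and B = B])
      show "\<exists>r>0. \<forall>w\<in>ball z r. w \<noteq> z \<longrightarrow> w \<notin> Z" if "z \<in> - S" for z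
        using isolated that S(2) by simp
      show "?R = - S - Z" using R_eq S(2) by simp
      show "C2_on ?R X" by (rule C2_on_subset[OF C2_X]) (auto dest: RU)
      show "frechet_derivative Y (at \<xi>) v \<bullet> frechet_derivative Y (at \<xi>) w = 2 * Re (g \<xi>) * (v \<bullet> w)"
        if x: "\<xi> \<in> ?R" for \<xi> v w
      proof (rule conformal_of_first_form)
        show "linear (frechet_derivative Y (at \<xi>))"
          by (rule linear_frechet_derivative[OF C2_on_differentiable[OF Y(1) x]])
        show "frechet_derivative Y (at \<xi>) v \<in> su" for v
          by (rule frechet_in_su[OF open_regular C2_on_differentiable[OF Y(1) x] x]) (use Y(2) in blast)
        show "su_inner (frechet_derivative Y (at \<xi>) v) (frechet_derivative Y (at \<xi>) v) = g \<xi> * v * cnj v" for v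
          using I[OF x, of v] first_form_eq[OF RU(1)[OF x], of v] by (simp add: first_form_def)
      qed
      show "2 * Re (g \<xi>) \<noteq> 0" if "\<xi> \<in> ?R" for \<xi> using Re_g_nonzero[OF RU[OF that]] by simp
      show "continuous_on UNIV B"
        unfolding B_def by (intro continuous_intros sphere_derivative_bound(1)[OF Q(1)])
      show "(B \<longlongrightarrow> 0) at_infinity"
        using tendsto_mult_right[OF tendsto_add[OF sphere_derivative_bound(2)[OF Q(1), of 1]
            sphere_derivative_bound(2)[OF Q(1), of \<i>]], of K]
        by (simp add: B_def)
      show "norm (frechet_derivative X (at \<xi>) 1) + norm (frechet_derivative X (at \<xi>) \<i>) \<le> B \<xi>" if x: "\<xi> \<in> ?R" for \<xi>
        using K[of "frechet_derivative P (at \<xi>) 1"] K[of "frechet_derivative P (at \<xi>) \<i>"]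
        unfolding frechet_X[OF RU(1)[OF x]] B_def DP[OF RU(1)[OF x], symmetric] distrib_right by (rule add_mono)
      show "second_form Y \<xi> v = L (second_form X \<xi> v)" if "\<xi> \<in> ?R" for \<xi> v by (rule L(2)[OF that])
    qed (use X_su frechet_X_conformal Y L(1) RU in auto)
  qed
  then obtain C where C: "C \<in> su" "\<And>\<xi>. \<xi> \<in> ?R \<Longrightarrow> Y \<xi> = L (X \<xi>) + C" by blast
  have "euclidean_motion (\<lambda>A. L A + C)"
    unfolding euclidean_motion_def using L(1) C(1) by blast
  then show ?thesis using C(2) by (intro exI[of _ "\<lambda>A. L A + C"]) simp
qed

end

section \<open>The integration constant and the Bonnet-type theorem\<close>

text \<open>Each point is joined to a fixed base point by a polynomial path, along which both
  increments are values of the same integral.\<close>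

lemma weierstrass_immersion_unique:
  assumes U: "open U" "connected U" "U \<noteq> {}"
    and X: "weierstrass_immersion U P X" and Y: "weierstrass_immersion U P Y"
  shows "\<exists>C\<in>su. \<forall>\<xi>\<in>U. Y \<xi> = X \<xi> + C"
proof -
  obtain x0 where x0: "x0 \<in> U" using U(3) by blast
  have "Y \<xi> = X \<xi> + (Y x0 - X x0)" if "\<xi> \<in> U" for \<xi>
  proof -
    obtain \<gamma> where \<gamma>: "polynomial_function \<gamma>" "path_image \<gamma> \<subseteq> U" "pathstart \<gamma> = x0" "pathfinish \<gamma> = \<xi>"
      using connected_open_polynomial_connected[OF U(1,2) x0 \<open>\<xi> \<in> U\<close>] by blast
    then have "has_weierstrass_integral P \<gamma> (X \<xi> - X x0)" "has_weierstrass_integral P \<gamma> (Y \<xi> - Y x0)"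
      using X Y valid_path_polynomial_function[OF \<gamma>(1)] unfolding weierstrass_immersion_def by metis+
    then have "X \<xi> - X x0 = Y \<xi> - Y x0"
      unfolding has_weierstrass_integral_def by (rule has_integral_unique)
    then show ?thesis by (simp add: algebra_simps)
  qed
  moreover have "Y x0 - X x0 \<in> su"
    using X Y x0 by (auto simp: weierstrass_immersion_def intro: su_diff)
  ultimately show ?thesis by blast
qed

theorem mainTheorem2:
  fixes f :: "complex \<Rightarrow> complex^'n" and S :: "complex set"
    and P :: "complex \<Rightarrow> complex^'n^'n" and \<epsilon> :: complex
  assumes "finite S"
    and "model_solution (- S) f"
    and "defined_on_sphere (- S) f"
    and "action (- S) f < \<infinity>"
    and "(holomorphic_vec (- S) f \<and> \<epsilon> = 1) \<or> (antiholomorphic_vec (- S) f \<and> \<epsilon> = - 1)"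
    and "P = projector f"
  shows
    "weierstrass_immersion (- S) P
       (\<lambda>\<xi>. (\<epsilon> * \<i>) \<cdot>\<^sub>C (mat ((1 - of_nat CARD('n)) / of_nat CARD('n)) + P \<xi>))
     \<and> (\<forall>X. weierstrass_immersion (- S) P X \<longrightarrow>
         (\<exists>C\<in>su. \<forall>\<xi>\<in>- S.
            X \<xi> = (\<epsilon> * \<i>) \<cdot>\<^sub>C (mat ((1 - of_nat CARD('n)) / of_nat CARD('n)) + P \<xi>) + C)
       \<and> (\<forall>\<xi>\<in>- S. \<forall>v. first_form X \<xi> v = trace (dM P \<xi> ** dbarM P \<xi>) * v * cnj v)
       \<and> (\<forall>\<xi>\<in>regular_points (- S) X.
            let \<Gamma> = christoffel X \<xi> in
            (\<forall>v. second_form X \<xi> v = (\<epsilon> * \<i>) \<cdot>\<^sub>C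
                (v\<^sup>2 \<cdot>\<^sub>C (dM (dM P) \<xi> - \<Gamma> 1 1 1 \<cdot>\<^sub>C dM P \<xi> - \<Gamma> 2 1 1 \<cdot>\<^sub>C dbarM P \<xi>)
                 + (2 * v * cnj v) \<cdot>\<^sub>C dM (dbarM P) \<xi>
                 + (cnj v)\<^sup>2 \<cdot>\<^sub>C
                     (dbarM (dbarM P) \<xi> - \<Gamma> 1 2 2 \<cdot>\<^sub>C dM P \<xi> - \<Gamma> 2 2 2 \<cdot>\<^sub>C dbarM P \<xi>)))
            \<and> trace (dM P \<xi> ** dbarM P \<xi>) \<noteq> 0
            \<and> \<Gamma> 1 1 1 = trace (dM (dM P) \<xi> ** dbarM P \<xi>) / trace (dM P \<xi> ** dbarM P \<xi>)
            \<and> \<Gamma> 2 1 1 = trace (dM (dM P) \<xi> ** dM P \<xi>) / trace (dM P \<xi> ** dbarM P \<xi>)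
            \<and> \<Gamma> 1 1 2 = 0 \<and> \<Gamma> 1 2 1 = 0
            \<and> \<Gamma> 1 2 2 = trace (dbarM (dbarM P) \<xi> ** dbarM P \<xi>) / trace (dM P \<xi> ** dbarM P \<xi>)
            \<and> \<Gamma> 2 2 2 = trace (dbarM (dbarM P) \<xi> ** dM P \<xi>) / trace (dM P \<xi> ** dbarM P \<xi>)
            \<and> \<Gamma> 2 1 2 = 0 \<and> \<Gamma> 2 2 1 = 0)
       \<and> (\<forall>Y. C2_on (regular_points (- S) X) Y \<and> Y ` regular_points (- S) X \<subseteq> su \<longrightarrow>
            (same_fundamental_forms (regular_points (- S) X) X Y \<longleftrightarrow>
             (\<exists>T. euclidean_motion T \<and> (\<forall>\<xi>\<in>regular_points (- S) X. Y \<xi> = T (X \<xi>))))))"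
proof -
  let ?U = "- S"
  define X0 where "X0 = (\<lambda>\<xi>. (\<epsilon> * \<i>) \<cdot>\<^sub>C (mat ((1 - of_nat CARD('n)) / of_nat CARD('n)) + P \<xi>))"
  have openU: "open ?U" using assms(1) by (simp add: finite_imp_closed open_Compl)
  \<comment> \<open>The complement of a countable set in the plane is path connected.\<close>
  have connU: "connected ?U"
    using assms(1) by (intro path_connected_imp_connected path_connected_complement_countable) (auto intro: countable_finite)
  have neU: "?U \<noteq> {}"
    using assms(1) infinite_UNIV_char_0[where 'a = complex] by (metis Compl_UNIV_eq double_complement)
  have f: "C2_on ?U f" "\<And>\<xi>. \<xi> \<in> ?U \<Longrightarrow> f \<xi> \<noteq> 0"
    using assms(2) by (auto simp: model_solution_def)
  have C2P: "C2_on ?U P" unfolding assms(6) by (rule C2_on_projector[OF openU f])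
  have herm: "dagger (P \<xi>) = P \<xi>" for \<xi> by (simp add: assms(6) dagger_projector)
  note dag = dagger_wirtinger_hermitian[OF openU _ C2_on_differentiable[OF C2P] herm]
  have eps: "\<epsilon> = 1 \<or> \<epsilon> = - 1" using assms(5) by blast
  have comm: "commutator (dM P \<xi>) (P \<xi>) = - (\<epsilon> \<cdot>\<^sub>C dM P \<xi>) \<and> commutator (dbarM P \<xi>) (P \<xi>) = \<epsilon> \<cdot>\<^sub>C dbarM P \<xi>"
    if x: "\<xi> \<in> ?U" for \<xi>
    using assms(5)
  proof (elim disjE conjE)
    assume "holomorphic_vec ?U f" and e: "\<epsilon> = 1"
    then have "vec_wirtinger 2 f \<xi> = 0" using x by (simp add: holomorphic_vec_def)
    from projector_commutator[OF openU f x this, folded assms(6)]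
    show ?thesis using dag[OF x x] by (simp add: e cscale_simps)
  next
    \<comment> \<open>Now \<open>f\<close> is constant in the other index, so the same lemma
      produces both relations with reversed signs.\<close>
    assume "antiholomorphic_vec ?U f" and e: "\<epsilon> = - 1"
    then have "vec_wirtinger 1 f \<xi> = 0" using x by (simp add: antiholomorphic_vec_def)
    from projector_commutator[OF openU f x this, folded assms(6)]
    show ?thesis using dag[OF x x] by (simp add: e cscale_simps)
  qed
  have surface: "sigma_surface ?U P X \<epsilon> C"
    if "\<And>\<xi>. \<xi> \<in> ?U \<Longrightarrow> X \<xi> = (\<epsilon> * \<i>) \<cdot>\<^sub>C P \<xi> + C" "\<And>\<xi>. \<xi> \<in> ?U \<Longrightarrow> X \<xi> \<in> su" for X C
    by unfold_locales (use openU C2P herm comm eps that in auto)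
  let ?M = "(\<epsilon> * \<i>) \<cdot>\<^sub>C mat ((1 - of_nat CARD('n)) / of_nat CARD('n)) :: complex^'n^'n"
  have X0_eq: "X0 \<xi> = (\<epsilon> * \<i>) \<cdot>\<^sub>C P \<xi> + ?M" for \<xi>
    by (simp add: X0_def cscale_simps add.commute)
  \<comment> \<open>The factor \<open>\<epsilon> * \<i>\<close> makes a Hermitian matrix
    anti-Hermitian, and the scalar matrix contributes trace 1 - N against the trace N - 1 of
    \<open>P\<close>.\<close>
  have X0_su: "X0 \<xi> \<in> su" if "\<xi> \<in> ?U" for \<xi>
  proof -
    have "dagger (mat c :: complex^'n^'n) = mat (cnj c)" for c
      by (rule mat_eqI) (auto simp: dagger_nth mat_def)
    moreover have "trace (mat c :: complex^'n^'n) = of_nat CARD('n) * c" for c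
      by (simp add: trace_def mat_def)
    moreover have "cnj \<epsilon> = \<epsilon>" using eps by auto
    ultimately show ?thesis
      using trace_projector[of f \<xi>] f(2)[OF that]
      by (simp add: su_def X0_def dagger_simps herm trace_cscale trace_add cscale_simps)
        (simp add: assms(6), simp add: right_diff_distrib)
  qed
  interpret X0: sigma_surface ?U P X0 \<epsilon> ?M
    by (rule surface[OF X0_eq X0_su])
  have W0: "weierstrass_immersion ?U P X0"
    unfolding weierstrass_immersion_def using X0_su X0.weierstrass_integral by blast
  obtain Q where Q: "C2_on_sphere Q" "\<And>\<xi>. \<xi> \<in> ?U \<Longrightarrow> Q \<xi> = P \<xi>"
    using assms(3,6) by (auto simp: defined_on_sphere_def)
  have discrete: "\<exists>r>0. \<forall>w\<in>ball z r. w \<noteq> z \<longrightarrow> w \<in> ?U \<longrightarrow> dM P w \<noteq> 0"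
    if "x0 \<in> ?U" "dM P x0 \<noteq> 0" "z \<in> ?U" for x0 z
    unfolding assms(6)
    by (rule projector_critical_discrete[OF openU connU f _ that(1) _ that(3)]) (use assms(5) that(2) in \<open>auto simp: assms(6)\<close>)
  show ?thesis
  proof (intro conjI allI impI)
    show "weierstrass_immersion ?U P (\<lambda>\<xi>. (\<epsilon> * \<i>) \<cdot>\<^sub>C (mat ((1 - of_nat CARD('n)) / of_nat CARD('n)) + P \<xi>))"
      using W0 by (simp add: X0_def)
    fix X assume W: "weierstrass_immersion ?U P X"
    obtain C where C: "C \<in> su" "\<And>\<xi>. \<xi> \<in> ?U \<Longrightarrow> X \<xi> = X0 \<xi> + C"
      using weierstrass_immersion_unique[OF openU connU neU W0 W] by blast
    have Xsu: "X \<xi> \<in> su" if "\<xi> \<in> ?U" for \<xi> using W that by (auto simp: weierstrass_immersion_def)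
    \<comment> \<open>An arbitrary immersion differs from \<open>X0\<close> by a constant, so the
      locale applies to it with that constant added.\<close>
    interpret X: sigma_surface ?U P X \<epsilon> "?M + C"
      by (rule surface[OF _ Xsu]) (simp add: C(2) X0_eq add.assoc)
    show "\<exists>C\<in>su. \<forall>\<xi>\<in>?U.
        X \<xi> = (\<epsilon> * \<i>) \<cdot>\<^sub>C (mat ((1 - of_nat CARD('n)) / of_nat CARD('n)) + P \<xi>) + C"
      using C by (auto simp: X0_def)
    show "\<forall>\<xi>\<in>?U. \<forall>v. first_form X \<xi> v = trace (dM P \<xi> ** dbarM P \<xi>) * v * cnj v"
      using X.first_form_eq by blast
    have reg: "\<xi> \<in> ?U" "trace (dM P \<xi> ** dbarM P \<xi>) \<noteq> 0" if "\<xi> \<in> regular_points ?U X" for \<xi>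
      using that by (auto simp: X.regular_points_eq)
    show "same_fundamental_forms (regular_points ?U X) X Y \<longleftrightarrow>
             (\<exists>T. euclidean_motion T \<and> (\<forall>\<xi>\<in>regular_points ?U X. Y \<xi> = T (X \<xi>)))"
      if Y: "C2_on (regular_points ?U X) Y \<and> Y ` regular_points ?U X \<subseteq> su" for Y
    proof
      assume same: "same_fundamental_forms (regular_points ?U X) X Y"
      show "\<exists>T. euclidean_motion T \<and> (\<forall>\<xi>\<in>regular_points ?U X. Y \<xi> = T (X \<xi>))"
        by (rule X.same_forms_euclidean_motion[OF assms(1) refl connU _ Q(1) _ Y[THEN conjunct1] Y[THEN conjunct2] same])
          (fact discrete, fact Q(2))
    next
      assume "\<exists>T. euclidean_motion T \<and> (\<forall>\<xi>\<in>regular_points ?U X. Y \<xi> = T (X \<xi>))"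
      then obtain T L D where T: "\<And>\<xi>. \<xi> \<in> regular_points ?U X \<Longrightarrow> Y \<xi> = T (X \<xi>)"
        "su_isometry L" "D \<in> su" "\<And>A. A \<in> su \<Longrightarrow> T A = L A + D"
        unfolding euclidean_motion_def by blast
      show "same_fundamental_forms (regular_points ?U X) X Y"
        by (rule X.euclidean_motion_same_forms[OF T(2,3)]) (simp add: T(1,4) Xsu[OF reg(1)])
    qed
    show "\<forall>\<xi>\<in>regular_points (- S) X.
            let \<Gamma> = christoffel X \<xi> in
            (\<forall>v. second_form X \<xi> v = (\<epsilon> * \<i>) \<cdot>\<^sub>C
                (v\<^sup>2 \<cdot>\<^sub>C (dM (dM P) \<xi> - \<Gamma> 1 1 1 \<cdot>\<^sub>C dM P \<xi> - \<Gamma> 2 1 1 \<cdot>\<^sub>C dbarM P \<xi>)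
                 + (2 * v * cnj v) \<cdot>\<^sub>C dM (dbarM P) \<xi>
                 + (cnj v)\<^sup>2 \<cdot>\<^sub>C
                     (dbarM (dbarM P) \<xi> - \<Gamma> 1 2 2 \<cdot>\<^sub>C dM P \<xi> - \<Gamma> 2 2 2 \<cdot>\<^sub>C dbarM P \<xi>)))
            \<and> trace (dM P \<xi> ** dbarM P \<xi>) \<noteq> 0
            \<and> \<Gamma> 1 1 1 = trace (dM (dM P) \<xi> ** dbarM P \<xi>) / trace (dM P \<xi> ** dbarM P \<xi>)
            \<and> \<Gamma> 2 1 1 = trace (dM (dM P) \<xi> ** dM P \<xi>) / trace (dM P \<xi> ** dbarM P \<xi>)
            \<and> \<Gamma> 1 1 2 = 0 \<and> \<Gamma> 1 2 1 = 0
            \<and> \<Gamma> 1 2 2 = trace (dbarM (dbarM P) \<xi> ** dbarM P \<xi>) / trace (dM P \<xi> ** dbarM P \<xi>)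
            \<and> \<Gamma> 2 2 2 = trace (dbarM (dbarM P) \<xi> ** dM P \<xi>) / trace (dM P \<xi> ** dbarM P \<xi>)
            \<and> \<Gamma> 2 1 2 = 0 \<and> \<Gamma> 2 2 1 = 0"
      unfolding Let_def
      using X.second_form_christoffel[OF reg] X.christoffel_traces[OF reg] reg(2)
      by (intro ballI conjI allI)
  qed
qed

end
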